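(* Let $G$ be a closed oligomorphic subgroup of $S_\infty$ with ample generic elements. Then $G$ has properties (FA) and (FH).
   Context: $S_\infty$ is the Polish group of all permutations of $\mathbb N$ with the pointwise convergence topology. A subgroup $G\leq S_\infty$ is oligomorphic if it has only finitely many orbits on $\mathbb N^n$ for each $n$. A Polish group $G$ has ample generic elements if for each finite $n\ge 1$ there is a comeager orbit for the diagonal conjugacy action of $G$ on $G^n$, $g\cdot(g_1,\dots,g_n)=(gg_1g^{-1},\dots,gg_ng^{-1})$. A tree is a graph in which any two vertices are connected by a unique path. $G$ acts without inversion on a tree $T$ if it acts by automorphisms of $T$ and there are no $g\in G$ and adjacent vertices $a,b$ with $g\cdot a=b$ and $g\cdot b=a$. Property (FA): whenever $G$ (as an abstract group) acts without inversion on a tree, some vertex is fixed by all of $G$. Property (FH): every action of $G$ (as an abstract group) by isometries on a real Hilbert space has a fixed point. *)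

theory Defs
  imports
    "Graph_Theory.Pair_Digraph"
    "HOL-Analysis.Analysis"
    "HOL-Algebra.Group_Action"
begin

abbreviation S_infty :: "(nat \<Rightarrow> nat) monoid" where
  "S_infty \<equiv> BijGroup (UNIV :: nat set)"

definition S_infty_topology :: "(nat \<Rightarrow> nat) topology" where
  "S_infty_topology =
     subtopology (product_topology (\<lambda>_ :: nat. discrete_topology (UNIV :: nat set)) UNIV)
       (carrier S_infty)"

abbreviation subgroup_of_S_infty :: "(nat \<Rightarrow> nat) set \<Rightarrow> (nat \<Rightarrow> nat) monoid" where
  "subgroup_of_S_infty G \<equiv> S_infty\<lparr>carrier := G\<rparr>"

text \<open>The elements of \<open>\<nat>\<^sup>n\<close> are the lists of length \<open>n\<close>; a permutation \<open>g\<close> acts on them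
  coordinatewise, that is, by \<open>map g\<close>.\<close>

definition oligomorphic :: "(nat \<Rightarrow> nat) set \<Rightarrow> bool" where
  "oligomorphic G \<longleftrightarrow>
     (\<forall>n. finite (Group_Action.orbits (subgroup_of_S_infty G) {xs :: nat list. length xs = n} map))"

definition comeager_in :: "'a topology \<Rightarrow> 'a set \<Rightarrow> bool" where
  "comeager_in X A \<longleftrightarrow> A \<subseteq> topspace X \<and>
     (\<exists>U :: nat \<Rightarrow> 'a set.
        (\<forall>i. openin X (U i) \<and> X closure_of U i = topspace X) \<and> (\<Inter>i. U i) \<subseteq> A)"

text \<open>The elements of the power \<open>H\<^sup>n\<close> are the extensional functions on \<open>{..<n}\<close>.\<close>

definition diagonal_conj ::
  "('g, 'm) monoid_scheme \<Rightarrow> nat \<Rightarrow> 'g \<Rightarrow> (nat \<Rightarrow> 'g) \<Rightarrow> (nat \<Rightarrow> 'g)" where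
  "diagonal_conj H n g x = (\<lambda>i\<in>{..<n}. g \<otimes>\<^bsub>H\<^esub> x i \<otimes>\<^bsub>H\<^esub> inv\<^bsub>H\<^esub> g)"

definition ample_generics :: "('g, 'm) monoid_scheme \<Rightarrow> 'g topology \<Rightarrow> bool" where
  "ample_generics H X \<longleftrightarrow>
     (\<forall>n\<ge>1. \<exists>C \<in> Group_Action.orbits H ({..<n} \<rightarrow>\<^sub>E carrier H) (diagonal_conj H n).
        comeager_in (product_topology (\<lambda>_. X) {..<n}) C)"

text \<open>A simple undirected graph is a loop-free symmetric digraph without parallel arcs. Trees are
  nonempty; otherwise no group would have property (FA). The constant
  \<open>Digraph_Component.tree\<close> of Graph_Theory is not suitable here: there,
  a pair of opposite arcs is a cycle.\<close>

definition undirected_tree :: "'v pair_pre_digraph \<Rightarrow> bool" where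
  "undirected_tree T \<longleftrightarrow> pair_bidirected_digraph T \<and> pverts T \<noteq> {} \<and>
     (\<forall>u\<in>pverts T. \<forall>v\<in>pverts T. \<exists>!p. pre_digraph.apath (with_proj T) u p v)"

definition acts_by_automorphisms ::
  "('g, 'm) monoid_scheme \<Rightarrow> 'v pair_pre_digraph \<Rightarrow> ('g \<Rightarrow> 'v \<Rightarrow> 'v) \<Rightarrow> bool" where
  "acts_by_automorphisms H T \<phi> \<longleftrightarrow> group_action H (pverts T) \<phi> \<and>
     (\<forall>g\<in>carrier H. \<forall>a\<in>pverts T. \<forall>b\<in>pverts T. (\<phi> g a, \<phi> g b) \<in> parcs T \<longleftrightarrow> (a, b) \<in> parcs T)"

definition acts_without_inversion ::
  "('g, 'm) monoid_scheme \<Rightarrow> 'v pair_pre_digraph \<Rightarrow> ('g \<Rightarrow> 'v \<Rightarrow> 'v) \<Rightarrow> bool" where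
  "acts_without_inversion H T \<phi> \<longleftrightarrow> acts_by_automorphisms H T \<phi> \<and>
     \<not> (\<exists>g\<in>carrier H. \<exists>a b. (a, b) \<in> parcs T \<and> \<phi> g a = b \<and> \<phi> g b = a)"

text \<open>A definition cannot quantify over types, so the type of the vertices, respectively the
  Hilbert space, is a parameter; a theorem stated for a type variable covers all of them.\<close>

definition property_FA :: "'v itself \<Rightarrow> ('g, 'm) monoid_scheme \<Rightarrow> bool" where
  "property_FA _ H \<longleftrightarrow>
     (\<forall>(T :: 'v pair_pre_digraph) \<phi>.
        undirected_tree T \<and> acts_without_inversion H T \<phi> \<longrightarrow>
        (\<exists>v\<in>pverts T. \<forall>g\<in>carrier H. \<phi> g v = v))"

text \<open>The isometries need not be linear.\<close>

definition property_FH ::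
  "'h::{real_inner, complete_space} itself \<Rightarrow> ('g, 'm) monoid_scheme \<Rightarrow> bool" where
  "property_FH _ H \<longleftrightarrow>
     (\<forall>\<phi>. group_action H (UNIV :: 'h set) \<phi> \<and>
          (\<forall>g\<in>carrier H. \<forall>x y. dist (\<phi> g x) (\<phi> g y) = dist x y) \<longrightarrow>
        (\<exists>x. \<forall>g\<in>carrier H. \<phi> g x = x))"

end

theory Submission
  imports Defs
begin

text \<open>
  Both properties follow from one fact about the group: every length function on \<open>G\<close>, that is,
  every \<open>len\<close> with \<open>len (g \<circ> h) \<le> len g + len h\<close> and \<open>len (inv g) \<le> len g\<close>, is bounded
  (\<open>length_function_bounded\<close>). If \<open>G\<close> acts by isometries on a metric space, the distance by which
  \<open>g\<close> displaces a base point is a length function, so orbits are bounded. In a Hilbert space a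
  bounded orbit has a unique Chebyshev centre, and uniqueness makes it a fixed point. In a tree the
  vertices of least eccentricity with respect to a bounded orbit form a single vertex or an edge, and
  an edge that is not fixed pointwise would be inverted.

  The argument for the boundedness is due to Kechris and Rosendal. The sets \<open>{len \<le> n}\<close> exhaust
  \<open>G\<close>, so by Baire's theorem they are non-meager from some \<open>n\<close> on. If for some \<open>r\<close> the set
  \<open>{len > 5 r}\<close> is meager in some nonempty open set, then this open set contains a coset of a basic open
  subgroup \<open>stab k\<close>, the pointwise stabilizer of \<open>{..<k}\<close>; any two elements of length at most \<open>5 r\<close>
  in it differ by a factor of length at most \<open>10 r\<close>, and every element of \<open>stab k\<close> is such a
  factor. So \<open>len\<close> is bounded on an open subgroup. As \<open>G\<close> is oligomorphic, there are only finitely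
  many double cosets of \<open>stab k\<close>, and \<open>len\<close> is bounded on all of \<open>G\<close>.

  In the remaining case every set \<open>{len > 5 n}\<close> is non-meager in every nonempty open set. Ample
  generics then yield a perfect family of elements \<open>L a\<close>, indexed by the branches \<open>a\<close> of the binary
  tree, such that whenever \<open>a\<close> and \<open>b\<close> split at level \<open>n\<close>, with \<open>a\<close> turning left, some
  \<open>inv (L a) \<circ> y \<circ> L a\<close> with \<open>len y \<le> n\<close> equals some \<open>inv (L b) \<circ> z \<circ> L b\<close> with \<open>len z > 5 n\<close>,
  up to a fixed shift of \<open>n\<close> (\<open>generic_conjugates_meet\<close>). There are uncountably many branches and countably many bounds, so
  two branches that split at some level \<open>n\<close> have \<open>len (L a) \<le> n\<close> and \<open>len (L b) \<le> n\<close>. Then an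
  element of length more than \<open>5 n\<close> is the conjugate of one of length at most \<open>n\<close> by an element of
  length at most \<open>2 n\<close>, which is absurd.

  Where do ample generics enter? One node of the tree needs, for a tuple \<open>c\<close> in the comeager orbit
  of length \<open>n\<close>, elements \<open>y\<close> and \<open>z\<close> of two prescribed sets such that an element close to the
  identity conjugates \<open>(c, y)\<close> to \<open>(c, z)\<close>. By the theorem of Kuratowski and Ulam \<open>(c, y)\<close> is in
  the comeager orbit of length \<open>n + 1\<close> for comeager many \<open>y\<close>. The \<open>stab k\<close>-orbits are relatively
  open in that orbit (\<open>stab_orbit_relatively_open\<close>, an instance of Effros' theorem that a
  back-and-forth construction proves directly). So all generic \<open>(c, z)\<close> with \<open>z\<close> close to \<open>y\<close>
  will do.
\<close>

section \<open>Fixed vertices of groups acting on trees\<close>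

definition walk_dist :: "'v rel \<Rightarrow> 'v \<Rightarrow> 'v \<Rightarrow> nat" where
  "walk_dist E u v = (LEAST n. (u, v) \<in> E ^^ n)"

lemma walk_dist_le: "(u, v) \<in> E ^^ n \<Longrightarrow> walk_dist E u v \<le> n"
  unfolding walk_dist_def by (rule Least_le)

lemma relpow_walk_dist: "(u, v) \<in> E\<^sup>* \<Longrightarrow> (u, v) \<in> E ^^ walk_dist E u v"
  unfolding walk_dist_def by (rule LeastI_ex) (auto dest: rtrancl_imp_relpow)

lemma walk_dist_triangle:
  assumes "(u, v) \<in> E\<^sup>*" "(v, w) \<in> E\<^sup>*"
  shows "walk_dist E u w \<le> walk_dist E u v + walk_dist E v w"
  using assms by (intro walk_dist_le) (auto simp: relpow_add intro: relpow_walk_dist)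

lemma relpow_image:
  assumes "(u, v) \<in> E ^^ n" and "\<And>a b. (a, b) \<in> E \<Longrightarrow> (f a, f b) \<in> F"
  shows "(f u, f v) \<in> F ^^ n"
  using assms(1) by (induction n arbitrary: v) (auto intro: assms(2))

lemma walk_dist_commute:
  assumes "sym E" "(u, v) \<in> E\<^sup>*"
  shows "walk_dist E u v = walk_dist E v u"
proof -
  have "(y, x) \<in> E ^^ n" if "(x, y) \<in> E ^^ n" for n x y
    using that
  proof (induction n arbitrary: y)
    case (Suc n)
    then show ?case by (meson assms(1) relpow_Suc_E relpow_Suc_I2 symD)
  qed simp
  then have "(x, y) \<in> E ^^ n \<longleftrightarrow> (y, x) \<in> E ^^ n" for n x y by blast
  then show ?thesis by (simp add: walk_dist_def)
qed

definition avoiding :: "'v rel \<Rightarrow> 'v \<Rightarrow> 'v rel" where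
  "avoiding E m = E \<inter> (- {m}) \<times> (- {m})"

text \<open>
  A shortest walk from \<open>u\<close> to \<open>x\<close> has to pass through \<open>m\<close> when \<open>m\<close> separates \<open>u\<close> from \<open>x\<close>; its
  final part, from \<open>m\<close> on, is shorter.
\<close>

lemma walk_dist_cut_vertex_less:
  assumes "(u, x) \<in> E\<^sup>*" "(u, x) \<notin> (avoiding E m)\<^sup>*" "u \<noteq> m"
  shows "walk_dist E m x < walk_dist E u x"
proof -
  have "\<exists>k<n. (m, x) \<in> E ^^ k" if "(u, x) \<in> E ^^ n" "(u, x) \<notin> (avoiding E m)\<^sup>*" "u \<noteq> m" for n u
    using that
  proof (induction n arbitrary: u)
    case (Suc n)
    obtain w where w: "(u, w) \<in> E" "(w, x) \<in> E ^^ n"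
      using Suc.prems(1) by (rule relpow_Suc_E2)
    show ?case
    proof (cases "w = m")
      case False
      then have "(u, w) \<in> avoiding E m" using w Suc.prems by (simp add: avoiding_def)
      then have "(w, x) \<notin> (avoiding E m)\<^sup>*" using Suc.prems(2) by (meson converse_rtrancl_into_rtrancl)
      then show ?thesis using Suc.IH[OF w(2)] False by (meson less_Suc_eq)
    qed (use w in auto)
  qed auto
  then obtain k where "k < walk_dist E u x" "(m, x) \<in> E ^^ k"
    using assms relpow_walk_dist by metis
  then show ?thesis using walk_dist_le by (metis le_less_trans)
qed

text \<open>
  The passage from unique paths to statements about the arc relation alone. The essential one is
  that two vertices that are neither equal nor adjacent are separated by a third one, namely the
  second vertex on the path between them.
\<close>

lemma undirected_treeD:
  assumes "undirected_tree T"
  shows undirected_tree_sym: "sym (parcs T)"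
    and undirected_tree_arc_verts: "(a, b) \<in> parcs T \<Longrightarrow> a \<in> pverts T \<and> b \<in> pverts T \<and> a \<noteq> b"
    and undirected_tree_reach: "u \<in> pverts T \<Longrightarrow> v \<in> pverts T \<Longrightarrow> (u, v) \<in> (parcs T)\<^sup>*"
    and undirected_tree_cut_vertex:
      "\<lbrakk>u \<in> pverts T; v \<in> pverts T; u \<noteq> v; (u, v) \<notin> parcs T\<rbrakk> \<Longrightarrow>
        \<exists>m\<in>pverts T. m \<noteq> u \<and> m \<noteq> v \<and> (u, v) \<notin> (avoiding (parcs T) m)\<^sup>*"
    and undirected_tree_triangle_free:
      "\<lbrakk>(a, b) \<in> parcs T; (b, c) \<in> parcs T; (a, c) \<in> parcs T\<rbrakk> \<Longrightarrow> False"
proof -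
  interpret pair_bidirected_digraph T using assms by (simp add: undirected_tree_def)
  have uniq: "\<exists>!p. apath u p v" if "u \<in> pverts T" "v \<in> pverts T" for u v
    using assms that unfolding undirected_tree_def by blast
  show sym: "sym (parcs T)" using pair_sym_arcs by (simp add: symmetric_def)
  show arc: "a \<in> pverts T \<and> b \<in> pverts T \<and> a \<noteq> b" if "(a, b) \<in> parcs T" for a b
    using that in_arcsD1 in_arcsD2 pair_no_loops by fastforce
  have walk_reach: "(u, v) \<in> (set p)\<^sup>*" if "awalk u p v" for u p v
    using that
  proof (induction p arbitrary: u)
    case (Cons e p)
    then have "(u, snd e) \<in> set (e # p)" "(snd e, v) \<in> (set p)\<^sup>*" by (auto simp: awalk_simps)
    moreover have "(set p)\<^sup>* \<subseteq> (set (e # p))\<^sup>*" by (rule rtrancl_mono) auto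
    ultimately show ?case by (meson converse_rtrancl_into_rtrancl subsetD)
  qed (simp add: awalk_simps)
  have reach_walk: "\<exists>p. awalk u p v \<and> set p \<subseteq> E" if "(u, v) \<in> E\<^sup>*" "v \<in> pverts T" "E \<subseteq> parcs T" for u v E
    using that
  proof (induction rule: converse_rtrancl_induct)
    case base
    then show ?case by (intro exI[of _ "[]"]) (simp add: awalk_simps)
  next
    case (step y z)
    then obtain p where "awalk z p v" "set p \<subseteq> E" by blast
    then show ?case using step by (intro exI[of _ "(y, z) # p"]) (auto simp: awalk_simps)
  qed
  show "(u, v) \<in> (parcs T)\<^sup>*" if uv: "u \<in> pverts T" "v \<in> pverts T" for u v
  proof -
    obtain p where p: "apath u p v" using uniq[OF uv] by blast
    then have "set p \<subseteq> parcs T" by (auto simp: apath_def awalk_def)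
    then show ?thesis using walk_reach[of u p v] p rtrancl_mono by (auto simp: apath_def)
  qed
  show "\<exists>m\<in>pverts T. m \<noteq> u \<and> m \<noteq> v \<and> (u, v) \<notin> (avoiding (parcs T) m)\<^sup>*"
    if uv: "u \<in> pverts T" "v \<in> pverts T" "u \<noteq> v" "(u, v) \<notin> parcs T" for u v
  proof -
    obtain p where p: "apath u p v" using uniq uv by blast
    then obtain e es where ees: "p = e # es" using uv by (cases p) (auto simp: apath_simps)
    then have e: "e \<in> parcs T" "fst e = u" "apath (snd e) es v"
      using p by (auto simp: apath_simps)
    \<comment> \<open>A walk avoiding the vertex \<open>?m\<close> would contain a path avoiding it, which differs from \<open>p\<close>.\<close>
    let ?m = "snd e"
    have arc_m: "(u, ?m) \<in> parcs T" using e by (metis prod.collapse)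
    have "(u, v) \<notin> (avoiding (parcs T) ?m)\<^sup>*"
    proof
      assume "(u, v) \<in> (avoiding (parcs T) ?m)\<^sup>*"
      then obtain q where q: "awalk u q v" "set q \<subseteq> avoiding (parcs T) ?m"
        using reach_walk[of u v "avoiding (parcs T) ?m"] uv by (auto simp: avoiding_def)
      then have "apath u (awalk_to_apath q) v" by (simp add: apath_awalk_to_apath)
      then have "awalk_to_apath q = p" using p uniq uv by blast
      then have "e \<in> set q" using awalk_to_apath_subset[OF q(1)] ees by auto
      then show False using q(2) by (auto simp: avoiding_def)
    qed
    then show ?thesis using arc[OF arc_m] arc_m uv by metis
  qed
  show False if "(a, b) \<in> parcs T" "(b, c) \<in> parcs T" "(a, c) \<in> parcs T" for a b c
  proof -
    have "apath a [(a, c)] c" "apath a [(a, b), (b, c)] c"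
      using that arc by (auto simp: apath_simps)
    then show False using uniq[of a c] arc[OF that(3)] by blast
  qed
qed

text \<open>
  Consider the vertices \<open>u\<close> that minimize the largest distance to the orbit of \<open>v0\<close>. Two of them,
  when not adjacent, are separated by some vertex \<open>m\<close>. Every point of the orbit is separated by \<open>m\<close>
  from at least one of the two, hence is closer to \<open>m\<close> than to that one, so \<open>m\<close> would have a
  smaller radius. The minimizers are thus pairwise adjacent, and as a tree has no triangles there
  are at most two of them. The group permutes them, and without inversions it cannot move any.
\<close>

lemma tree_bounded_orbit_fixed_vertex:
  assumes T: "undirected_tree T" and act: "acts_without_inversion H T \<phi>" and H: "group H"
    and v0: "v0 \<in> pverts T"
    and bounded: "\<And>g. g \<in> carrier H \<Longrightarrow> walk_dist (parcs T) v0 (\<phi> g v0) \<le> N"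
  shows "\<exists>v\<in>pverts T. \<forall>g\<in>carrier H. \<phi> g v = v"
proof -
  let ?E = "parcs T" and ?V = "pverts T"
  interpret group_action H ?V \<phi>
    using act by (simp add: acts_without_inversion_def acts_by_automorphisms_def)
  interpret group H by (rule H)
  have img: "\<phi> g u \<in> ?V" if "g \<in> carrier H" "u \<in> ?V" for g u
    using that element_image by blast
  have arc_img: "(\<phi> g a, \<phi> g b) \<in> ?E" if "g \<in> carrier H" "(a, b) \<in> ?E" for g a b
    using act that undirected_tree_arc_verts[OF T that(2)]
    by (simp add: acts_without_inversion_def acts_by_automorphisms_def)
  have reach: "(u, v) \<in> ?E\<^sup>*" if "u \<in> ?V" "v \<in> ?V" for u v
    using undirected_tree_reach[OF T] that by blast
  define in_radius where "in_radius r u \<longleftrightarrow> (\<forall>g\<in>carrier H. walk_dist ?E u (\<phi> g v0) \<le> r)" for r u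
  define r where "r = (LEAST r. \<exists>u\<in>?V. in_radius r u)"
  have "\<exists>u\<in>?V. in_radius N u" using v0 bounded by (auto simp: in_radius_def)
  then have ex: "\<exists>u\<in>?V. in_radius r u" unfolding r_def by (rule LeastI)
  have least: "r \<le> s" if "u \<in> ?V" "in_radius s u" for s u
    unfolding r_def using that by (intro Least_le) blast
  have adjacent: "(u, v) \<in> ?E"
    if uv: "u \<in> ?V" "v \<in> ?V" "in_radius r u" "in_radius r v" "u \<noteq> v" for u v
  proof (rule ccontr)
    assume "(u, v) \<notin> ?E"
    then obtain m where m: "m \<in> ?V" "m \<noteq> u" "m \<noteq> v" "(u, v) \<notin> (avoiding ?E m)\<^sup>*"
      using undirected_tree_cut_vertex[OF T] uv by blast
    have less: "walk_dist ?E m (\<phi> g v0) < r" if g: "g \<in> carrier H" for g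
    proof -
      let ?x = "\<phi> g v0"
      have "sym (avoiding ?E m)"
        using undirected_tree_sym[OF T] by (auto simp: avoiding_def sym_def)
      then have "(u, ?x) \<notin> (avoiding ?E m)\<^sup>* \<or> (v, ?x) \<notin> (avoiding ?E m)\<^sup>*"
        using m(4) by (meson rtrancl_trans sym_rtrancl symD)
      then have "walk_dist ?E m ?x < walk_dist ?E u ?x \<or> walk_dist ?E m ?x < walk_dist ?E v ?x"
        using walk_dist_cut_vertex_less reach uv m img[OF g v0] by metis
      then show ?thesis using uv g unfolding in_radius_def by (meson less_le_trans)
    qed
    have "r > 0" using less[OF one_closed] by simp
    moreover have "in_radius (r - 1) m" using less by (fastforce simp: in_radius_def)
    ultimately show False using least[OF m(1)] by fastforce
  qed
  have invariant: "in_radius r (\<phi> h u)" if h: "h \<in> carrier H" and u: "u \<in> ?V" "in_radius r u" for h u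
    unfolding in_radius_def
  proof
    fix g assume g: "g \<in> carrier H"
    let ?k = "inv\<^bsub>H\<^esub> h \<otimes>\<^bsub>H\<^esub> g"
    have k: "?k \<in> carrier H" using g h by simp
    have "\<phi> g v0 = \<phi> h (\<phi> ?k v0)"
      using composition_rule[OF v0 h k] g h by (simp add: m_assoc[symmetric])
    moreover have "(u, \<phi> ?k v0) \<in> ?E ^^ walk_dist ?E u (\<phi> ?k v0)"
      using relpow_walk_dist[OF reach] u img[OF k v0] by blast
    then have "(\<phi> h u, \<phi> h (\<phi> ?k v0)) \<in> ?E ^^ walk_dist ?E u (\<phi> ?k v0)"
      by (rule relpow_image) (rule arc_img[OF h])
    ultimately show "walk_dist ?E (\<phi> h u) (\<phi> g v0) \<le> r"
      using u(2) k walk_dist_le unfolding in_radius_def by (metis le_trans)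
  qed
  obtain u where u: "u \<in> ?V" "in_radius r u" using ex by blast
  have "\<phi> g u = u" if g: "g \<in> carrier H" for g
  proof (rule ccontr)
    assume ne: "\<phi> g u \<noteq> u"
    let ?w = "\<phi> g u"
    have w: "?w \<in> ?V" "in_radius r ?w" using img invariant g u by auto
    have gw: "\<phi> g ?w \<in> ?V" "in_radius r (\<phi> g ?w)" using img invariant g w by auto
    have uw: "(u, ?w) \<in> ?E" using adjacent u w ne by metis
    then have wgw: "(?w, \<phi> g ?w) \<in> ?E" by (rule arc_img[OF g])
    have "\<phi> g ?w = u"
    proof (rule ccontr)
      assume "\<phi> g ?w \<noteq> u"
      then have "(u, \<phi> g ?w) \<in> ?E" using adjacent u gw by metis
      then show False using undirected_tree_triangle_free[OF T uw wgw] by blast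
    qed
    then show False using act uw g unfolding acts_without_inversion_def by blast
  qed
  then show ?thesis using u by blast
qed

section \<open>Fixed points of isometric actions on Hilbert spaces\<close>

text \<open>
  Let \<open>R\<close> be the infimum of the radii of closed balls containing \<open>S\<close>. If the closed balls of radius \<open>a\<close> around
  \<open>u\<close> and \<open>w\<close> contain \<open>S\<close>, then by the parallelogram law so does the ball of radius
  \<open>sqrt (a\<^sup>2 - (norm (u - w))\<^sup>2 / 4)\<close> around their midpoint; hence \<open>u\<close> and \<open>w\<close> are close to each
  other once \<open>a\<close> is close to \<open>R\<close>. So the centres of almost optimal balls form a Cauchy sequence,
  and an optimal ball is unique.
\<close>

lemma unique_chebyshev_centre:
  fixes S :: "'h::{real_inner, complete_space} set"
  assumes "S \<noteq> {}" "bounded S"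
  shows "\<exists>R. \<exists>!c. \<forall>s\<in>S. dist c s \<le> R"
proof -
  define Q where "Q r u \<longleftrightarrow> (\<forall>s\<in>S. dist u s \<le> r)" for r and u :: 'h
  define R where "R = Inf {r. \<exists>u. Q r u}"
  have nonneg: "0 \<le> r" if "Q r u" for r u
    using that assms(1) unfolding Q_def by (meson ex_in_conv order_trans zero_le_dist)
  obtain x B where "\<forall>s\<in>S. dist x s \<le> B" using assms(2) by (auto simp: bounded_def)
  then have ne: "{r. \<exists>u. Q r u} \<noteq> {}" by (auto simp: Q_def)
  have bdd: "bdd_below {r. \<exists>u. Q r u}" using nonneg by (auto intro!: bdd_belowI[of _ 0])
  have R_le: "R \<le> r" if "Q r u" for r u
    unfolding R_def using bdd that by (intro cInf_lower) auto
  have R0: "0 \<le> R" unfolding R_def using ne nonneg by (intro cInf_greatest) auto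
  have close: "(norm (u - w))\<^sup>2 \<le> 4 * (a\<^sup>2 - R\<^sup>2)" if "Q a u" "Q a w" for a u w
  proof -
    let ?m = "(1/2) *\<^sub>R (u + w)" and ?b = "a\<^sup>2 - (norm (u - w))\<^sup>2 / 4"
    have le: "(dist ?m s)\<^sup>2 \<le> ?b" if "s \<in> S" for s
    proof -
      have mid: "?m - s = (1/2) *\<^sub>R ((u - s) + (w - s))"
        by (simp add: scaleR_2[symmetric] algebra_simps)
      have "(norm (?m - s))\<^sup>2 = ((norm (u - s))\<^sup>2 + (norm (w - s))\<^sup>2) / 2 - (norm (u - w))\<^sup>2 / 4"
        unfolding mid power2_norm_eq_inner by (simp add: inner_commute field_simps inner_add inner_diff)
      moreover have "(norm (u - s))\<^sup>2 \<le> a\<^sup>2" "(norm (w - s))\<^sup>2 \<le> a\<^sup>2"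
        using \<open>Q a u\<close> \<open>Q a w\<close> \<open>s \<in> S\<close> by (auto simp: Q_def dist_norm intro!: power_mono)
      ultimately show ?thesis by (simp add: dist_norm)
    qed
    then have b0: "0 \<le> ?b" using assms(1) by (meson ex_in_conv order_trans zero_le_power2)
    have "Q (sqrt ?b) ?m" using le real_le_rsqrt by (auto simp: Q_def)
    then have "R \<le> sqrt ?b" by (rule R_le)
    then have "R\<^sup>2 \<le> ?b" using R0 b0 by (metis power_mono real_sqrt_pow2)
    then show ?thesis by simp
  qed
  have "\<exists>u. Q (R + inverse (real (Suc n))) u" for n
  proof -
    obtain r v where "Q r v" "r < R + inverse (real (Suc n))"
      using cInf_lessD[OF ne, of "R + inverse (real (Suc n))"] by (auto simp: R_def)
    then have "Q (R + inverse (real (Suc n))) v"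
      unfolding Q_def by (meson less_imp_le order_trans)
    then show ?thesis by blast
  qed
  then obtain u where u: "\<And>n. Q (R + inverse (real (Suc n))) (u n)" by metis
  have "Cauchy u"
  proof (rule metric_CauchyI)
    fix e :: real assume e: "0 < e"
    have "(\<lambda>n. 4 * ((R + inverse (real (Suc n)))\<^sup>2 - R\<^sup>2)) \<longlonglongrightarrow> 4 * ((R + 0)\<^sup>2 - R\<^sup>2)"
      by (intro tendsto_intros LIMSEQ_inverse_real_of_nat)
    then have "(\<lambda>n. 4 * ((R + inverse (real (Suc n)))\<^sup>2 - R\<^sup>2)) \<longlonglongrightarrow> 0" by simp
    then have "\<forall>\<^sub>F n in sequentially. 4 * ((R + inverse (real (Suc n)))\<^sup>2 - R\<^sup>2) < e\<^sup>2"
      using e by (intro order_tendstoD) auto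
    then obtain M where M: "4 * ((R + inverse (real (Suc M)))\<^sup>2 - R\<^sup>2) < e\<^sup>2"
      by (auto simp: eventually_sequentially)
    have Q: "Q (R + inverse (real (Suc M))) (u n)" if "M \<le> n" for n
    proof -
      have "inverse (real (Suc n)) \<le> inverse (real (Suc M))" using that by simp
      then show ?thesis using u[of n] unfolding Q_def by (meson add_left_mono order_trans)
    qed
    have "dist (u m) (u n) < e" if "M \<le> m" "M \<le> n" for m n
    proof -
      have "(norm (u m - u n))\<^sup>2 < e\<^sup>2" using close[OF Q Q, OF that] M by linarith
      then show ?thesis using e by (simp add: dist_norm power2_less_imp_less)
    qed
    then show "\<exists>M. \<forall>m\<ge>M. \<forall>n\<ge>M. dist (u m) (u n) < e" by blast
  qed
  then obtain c where c: "u \<longlonglongrightarrow> c" using Cauchy_convergent_iff convergent_def by blast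
  have "Q R c"
    unfolding Q_def
  proof
    fix s assume s: "s \<in> S"
    have "(\<lambda>n. R + inverse (real (Suc n))) \<longlonglongrightarrow> R + 0"
      by (intro tendsto_intros LIMSEQ_inverse_real_of_nat)
    moreover have "(\<lambda>n. dist (u n) s) \<longlonglongrightarrow> dist c s" by (intro tendsto_intros c)
    ultimately show "dist c s \<le> R"
      using u s by (intro LIMSEQ_le) (auto simp: Q_def)
  qed
  moreover have "w = c" if "Q R w" for w
    using close[OF that \<open>Q R c\<close>] by simp
  ultimately show ?thesis unfolding Q_def by blast
qed

text \<open>The group maps the orbit to itself, so it fixes the Chebyshev centre of the orbit.\<close>

lemma hilbert_bounded_orbit_fixed_point:
  fixes \<phi> :: "'g \<Rightarrow> 'h::{real_inner, complete_space} \<Rightarrow> 'h"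
  assumes act: "group_action H UNIV \<phi>" and H: "group H"
    and isom: "\<And>g x y. g \<in> carrier H \<Longrightarrow> dist (\<phi> g x) (\<phi> g y) = dist x y"
    and bounded: "bounded ((\<lambda>g. \<phi> g x0) ` carrier H)"
  shows "\<exists>x. \<forall>g\<in>carrier H. \<phi> g x = x"
proof -
  interpret group_action H UNIV \<phi> by (rule act)
  interpret group H by (rule H)
  let ?S = "(\<lambda>g. \<phi> g x0) ` carrier H"
  have "?S \<noteq> {}" using one_closed by blast
  then obtain R c where c: "\<forall>s\<in>?S. dist c s \<le> R"
    and uniq: "\<And>w. \<forall>s\<in>?S. dist w s \<le> R \<Longrightarrow> w = c"
    using unique_chebyshev_centre[OF _ bounded] by blast
  have "\<phi> h c = c" if h: "h \<in> carrier H" for h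
  proof (rule uniq, clarify)
    fix g assume g: "g \<in> carrier H"
    let ?k = "inv\<^bsub>H\<^esub> h \<otimes>\<^bsub>H\<^esub> g"
    have k: "?k \<in> carrier H" using g h by simp
    have "\<phi> g x0 = \<phi> h (\<phi> ?k x0)"
      using composition_rule[OF UNIV_I h k] g h by (simp add: m_assoc[symmetric])
    then have "dist (\<phi> h c) (\<phi> g x0) = dist c (\<phi> ?k x0)" using isom[OF h] by simp
    then show "dist (\<phi> h c) (\<phi> g x0) \<le> R" using c k by auto
  qed
  then show ?thesis by blast
qed

section \<open>Comeager sets\<close>

definition meager_in :: "'a topology \<Rightarrow> 'a set \<Rightarrow> bool" where
  "meager_in X A \<longleftrightarrow> comeager_in X (topspace X - A)"

lemma comeager_in_mono: "comeager_in X A \<Longrightarrow> A \<subseteq> B \<Longrightarrow> B \<subseteq> topspace X \<Longrightarrow> comeager_in X B"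
  unfolding comeager_in_def by (meson order_trans)

lemma comeager_inE:
  assumes "comeager_in X A"
  obtains U :: "nat \<Rightarrow> 'a set" where "\<And>i. openin X (U i)" "\<And>i. X closure_of U i = topspace X"
    "(\<Inter>i. U i) \<subseteq> A"
  using assms unfolding comeager_in_def by metis

lemma comeager_inI:
  fixes U :: "nat \<Rightarrow> 'a set"
  assumes "A \<subseteq> topspace X" "\<And>i. openin X (U i)" "\<And>i. X closure_of U i = topspace X"
    "(\<Inter>i. U i) \<subseteq> A"
  shows "comeager_in X A"
  using assms unfolding comeager_in_def by metis

lemma comeager_in_subset: "comeager_in X A \<Longrightarrow> A \<subseteq> topspace X"
  by (simp add: comeager_in_def)

lemma comeager_in_open_dense:
  assumes "openin X U" "X closure_of U = topspace X" shows "comeager_in X U"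
  using assms unfolding comeager_in_def by (auto dest: openin_subset intro!: exI[of _ "\<lambda>_. U"])

lemma comeager_in_INT:
  assumes "\<And>n :: nat. comeager_in X (A n)"
  shows "comeager_in X (\<Inter>n. A n)"
proof -
  obtain U where U: "\<And>n i. openin X (U n i)" "\<And>n i. X closure_of U n i = topspace X"
    "\<And>n. (\<Inter>i :: nat. U n i) \<subseteq> A n"
    using assms unfolding comeager_in_def by metis
  define W where "W k = U (fst (prod_decode k)) (snd (prod_decode k))" for k
  have "(\<Inter>k. W k) \<subseteq> A n" for n
  proof -
    have "(\<Inter>k. W k) \<subseteq> U n i" for i
      using INF_lower[of "prod_encode (n, i)" UNIV W] by (simp add: W_def)
    then have "(\<Inter>k. W k) \<subseteq> (\<Inter>i. U n i)" by (rule INT_greatest)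
    then show ?thesis using U(3) by (rule order_trans)
  qed
  then have "(\<Inter>k. W k) \<subseteq> (\<Inter>n. A n)" by (rule INT_greatest)
  moreover have "(\<Inter>n. A n) \<subseteq> topspace X" using comeager_in_subset[OF assms] by blast
  moreover have "openin X (W k)" "X closure_of W k = topspace X" for k
    unfolding W_def by (rule U)+
  ultimately show ?thesis by (intro comeager_inI[of _ _ W])
qed

lemma comeager_in_Int:
  assumes "comeager_in X A" "comeager_in X B"
  shows "comeager_in X (A \<inter> B)"
proof -
  have "(\<Inter>n :: nat. if n = 0 then A else B) = A \<inter> B" by (auto split: if_splits)
  then show ?thesis
    using comeager_in_INT[of X "\<lambda>n. if n = 0 then A else B"] assms by simp
qed

lemma comeager_in_meets_open:
  assumes "completely_metrizable_space X" "comeager_in X A" "openin X U" "U \<noteq> {}"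
  shows "A \<inter> U \<noteq> {}"
proof -
  obtain W :: "nat \<Rightarrow> 'a set" where W: "\<And>i. openin X (W i)"
    "\<And>i. X closure_of W i = topspace X" "(\<Inter>i. W i) \<subseteq> A"
    using comeager_inE[OF assms(2)] by metis
  have "X closure_of (\<Inter>(range W)) = topspace X"
    using assms(1) W(1,2) by (intro Baire_category) auto
  then show ?thesis using assms(3,4) W(3) unfolding dense_intersects_open by blast
qed

lemma comeager_in_nonempty:
  assumes "completely_metrizable_space X" "comeager_in X A" "topspace X \<noteq> {}"
  shows "A \<noteq> {}"
  using comeager_in_meets_open[OF assms(1,2) openin_topspace assms(3)] by blast

lemma comeager_in_homeomorphic_preimage:
  assumes hom: "homeomorphic_map X Y f" and A: "comeager_in Y A"
  shows "comeager_in X {x \<in> topspace X. f x \<in> A}"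
proof -
  obtain W :: "nat \<Rightarrow> 'b set" where W: "\<And>i. openin Y (W i)"
    "\<And>i. Y closure_of W i = topspace Y" "(\<Inter>i. W i) \<subseteq> A"
    using comeager_inE[OF A] by metis
  let ?W = "\<lambda>i. {x \<in> topspace X. f x \<in> W i}"
  have "openin X (?W i)" for i
    using homeomorphic_imp_continuous_map[OF hom] W(1) by (rule openin_continuous_map_preimage)
  moreover have "X closure_of (?W i) = topspace X" for i
    unfolding dense_intersects_open
  proof (intro allI impI)
    fix U assume U: "openin X U \<and> U \<noteq> {}"
    then have "openin Y (f ` U)" "f ` U \<noteq> {}"
      using homeomorphic_map_openness[OF hom] openin_subset by auto
    then have "W i \<inter> f ` U \<noteq> {}" using W(2)[of i] unfolding dense_intersects_open by blast
    then show "?W i \<inter> U \<noteq> {}" using U openin_subset by fastforce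
  qed
  ultimately show ?thesis
    using W(3) by (intro comeager_inI[of _ _ ?W]) auto
qed

text \<open>
  For a dense open set \<open>W\<close> and a nonempty open \<open>V \<subseteq> X i\<close> the points \<open>x\<close> whose section
  \<open>{y. x(i := y) \<in> W}\<close> meets \<open>V\<close> form a dense open set. Intersecting over a countable base of
  sets \<open>V\<close> gives comeager many \<open>x\<close> for which the section is dense; it is open anyway.
\<close>

lemma kuratowski_ulam:
  fixes X :: "'i \<Rightarrow> 'a topology"
  assumes sc: "second_countable (X i)" and i: "i \<notin> I"
    and C: "comeager_in (product_topology X (insert i I)) C"
  shows "comeager_in (product_topology X I)
    {x \<in> topspace (product_topology X I). comeager_in (X i) {y \<in> topspace (X i). x(i := y) \<in> C}}"
    (is "comeager_in ?Y ?D")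
proof -
  let ?Z = "product_topology X (insert i I)"
  have upd: "x(i := y) \<in> topspace ?Z" if "x \<in> topspace ?Y" "y \<in> topspace (X i)" for x y
    using that i by (auto simp: PiE_iff extensional_def)
  have cont_left: "continuous_map ?Y ?Z (\<lambda>x. x(i := y))" if "y \<in> topspace (X i)" for y
    using that i unfolding continuous_map_componentwise
    by (auto simp: extensional_def PiE_iff intro!: continuous_map_product_projection)
  have cont_right: "continuous_map (X i) ?Z (\<lambda>y. x(i := y))" if "x \<in> topspace ?Y" for x
    using that i unfolding continuous_map_componentwise
    by (auto simp: extensional_def PiE_iff)
  obtain \<B> where \<B>: "countable \<B>" "\<And>V. V \<in> \<B> \<Longrightarrow> openin (X i) V"
    "\<And>U x. openin (X i) U \<Longrightarrow> x \<in> U \<Longrightarrow> \<exists>V\<in>\<B>. x \<in> V \<and> V \<subseteq> U"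
    using sc unfolding second_countable_def by metis
  \<comment> \<open>The full space is added so that the family is nonempty and can be enumerated.\<close>
  define \<B>' where "\<B>' = insert (topspace (X i)) (\<B> - {{}})"
  have \<B>': "countable \<B>'" "\<B>' \<noteq> {}" "\<And>V. V \<in> \<B>' \<Longrightarrow> openin (X i) V"
    using \<B> by (auto simp: \<B>'_def)
  obtain W :: "nat \<Rightarrow> ('i \<Rightarrow> 'a) set" where W: "\<And>k. openin ?Z (W k)"
    "\<And>k. ?Z closure_of W k = topspace ?Z" "(\<Inter>k. W k) \<subseteq> C"
    using comeager_inE[OF C] by metis
  define S where "S k V = {x \<in> topspace ?Y. \<exists>y\<in>V. x(i := y) \<in> W k}" for k V
  show ?thesis
  proof (cases "topspace (X i) = {}")
    case True
    then have "comeager_in (X i) {y \<in> topspace (X i). x(i := y) \<in> C}" for x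
      by (intro comeager_inI[of _ _ "\<lambda>_. {}"]) auto
    then have "?D = topspace ?Y" by blast
    then show ?thesis by (simp add: comeager_in_open_dense del: topspace_product_topology)
  next
    case False
    have "comeager_in ?Y (S k V)" if V: "V \<in> \<B>'" for k V
    proof (rule comeager_in_open_dense)
      have "S k V = (\<Union>y\<in>V. {x \<in> topspace ?Y. x(i := y) \<in> W k})" by (auto simp: S_def)
      moreover have "openin ?Y {x \<in> topspace ?Y. x(i := y) \<in> W k}" if "y \<in> V" for y
        using openin_continuous_map_preimage[OF cont_left W(1)] that openin_subset[OF \<B>'(3)[OF V]]
        by blast
      ultimately show "openin ?Y (S k V)" by auto
      show "?Y closure_of S k V = topspace ?Y"
        unfolding dense_intersects_open
      proof (intro allI impI)
        fix U assume U: "openin ?Y U \<and> U \<noteq> {}"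
        let ?U = "{z \<in> topspace ?Z. restrict z I \<in> U} \<inter> {z \<in> topspace ?Z. z i \<in> V}"
        have restr: "continuous_map ?Z ?Y (\<lambda>z. restrict z I)"
          unfolding continuous_map_componentwise
          by (auto intro!: continuous_map_product_projection)
        have "openin ?Z {z \<in> topspace ?Z. restrict z I \<in> U}"
          using U by (intro openin_continuous_map_preimage[OF restr]) auto
        moreover have "openin ?Z {z \<in> topspace ?Z. z i \<in> V}"
          using \<B>'(3)[OF V]
          by (intro openin_continuous_map_preimage[OF continuous_map_product_projection]) auto
        ultimately have "openin ?Z ?U" by (rule openin_Int)
        moreover obtain x y where xy: "x \<in> U" "y \<in> V"
          using U V False unfolding \<B>'_def by (metis Diff_iff equals0I insertE singletonI)
        then have x: "x \<in> topspace ?Y" and y: "y \<in> topspace (X i)"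
          using U openin_subset \<B>'(3)[OF V] by blast+
        have "restrict (x(i := y)) I = x"
          using x i by (auto simp: PiE_iff extensional_def fun_eq_iff restrict_def)
        then have "x(i := y) \<in> ?U" using upd[OF x y] xy by simp
        ultimately obtain z where z: "z \<in> W k" "z \<in> ?U"
          using W(2)[of k] unfolding dense_intersects_open by blast
        have "z = (restrict z I)(i := z i)"
          using z by (auto simp: PiE_iff extensional_def fun_eq_iff restrict_def)
        then have "restrict z I \<in> topspace ?Y \<and> (restrict z I)(i := z i) \<in> W k \<and> z i \<in> V"
          using z by auto
        then have "restrict z I \<in> S k V" unfolding S_def by blast
        then show "S k V \<inter> U \<noteq> {}" using z by blast
      qed
    qed
    then have "comeager_in ?Y (\<Inter>j. S k (from_nat_into \<B>' j))" for k
      by (intro comeager_in_INT) (simp add: from_nat_into \<B>'(2))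
    then have "comeager_in ?Y (\<Inter>k. \<Inter>j. S k (from_nat_into \<B>' j))"
      by (rule comeager_in_INT)
    then show ?thesis
    proof (rule comeager_in_mono)
      show "(\<Inter>k. \<Inter>j. S k (from_nat_into \<B>' j)) \<subseteq> ?D"
      proof
        fix x assume "x \<in> (\<Inter>k. \<Inter>j. S k (from_nat_into \<B>' j))"
        then have "x \<in> S k (from_nat_into \<B>' j)" for k j by simp
        then have xS: "x \<in> S k V" if V: "V \<in> \<B>'" for k V
        proof -
          obtain j where "from_nat_into \<B>' j = V" using from_nat_into_surj[OF \<B>'(1) V] by blast
          then show ?thesis using \<open>\<And>k j. x \<in> S k (from_nat_into \<B>' j)\<close>[of k j] by simp
        qed
        obtain V where "V \<in> \<B>'" using \<B>'(2) by blast
        then have x: "x \<in> topspace ?Y" using xS[of V 0] by (simp add: S_def)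
        let ?W = "\<lambda>k. {y \<in> topspace (X i). x(i := y) \<in> W k}"
        have "comeager_in (X i) (?W k)" for k
        proof (rule comeager_in_open_dense)
          show "openin (X i) (?W k)"
            using cont_right[OF x] W(1) by (rule openin_continuous_map_preimage)
          show "X i closure_of ?W k = topspace (X i)"
            unfolding dense_intersects_open
          proof (intro allI impI)
            fix U assume U: "openin (X i) U \<and> U \<noteq> {}"
            then obtain y where "y \<in> U" by blast
            then obtain V where "V \<in> \<B>" "y \<in> V" "V \<subseteq> U" using \<B>(3) U by blast
            then have V: "V \<in> \<B>'" "V \<subseteq> U" by (auto simp: \<B>'_def)
            obtain y' where "y' \<in> V" "x(i := y') \<in> W k" using xS[OF V(1), of k] by (auto simp: S_def)
            moreover have "y' \<in> topspace (X i)" using V(2) U openin_subset \<open>y' \<in> V\<close> by blast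
            ultimately show "?W k \<inter> U \<noteq> {}" using V(2) by blast
          qed
        qed
        then have "comeager_in (X i) (\<Inter>k. ?W k)" by (rule comeager_in_INT)
        then have "comeager_in (X i) {y \<in> topspace (X i). x(i := y) \<in> C}"
        proof (rule comeager_in_mono)
          show "(\<Inter>k. ?W k) \<subseteq> {y \<in> topspace (X i). x(i := y) \<in> C}"
          proof (intro subsetI CollectI conjI)
            fix y assume y: "y \<in> (\<Inter>k. ?W k)"
            then show "y \<in> topspace (X i)" by simp
            have "x(i := y) \<in> (\<Inter>k. W k)" using y by simp
            then show "x(i := y) \<in> C" by (rule subsetD[OF W(3)])
          qed
        qed blast
        then show "x \<in> ?D" using x by simp
      qed
    qed auto
  qed
qed

section \<open>Closed permutation groups\<close>

text \<open>From here on \<open>inv\<close> is the inverse of a function.\<close>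

unbundle no m_inv_syntax

lemma bij_inv_apply: "bij f \<Longrightarrow> inv f (f x) = x" "bij f \<Longrightarrow> f (inv f x) = x"
  by (simp_all add: bij_is_inj bij_is_surj surj_f_inv_f)

lemma S_infty_simps:
  "carrier S_infty = {f. bij f}"
  "bij f \<Longrightarrow> bij g \<Longrightarrow> f \<otimes>\<^bsub>S_infty\<^esub> g = f \<circ> g"
  "\<one>\<^bsub>S_infty\<^esub> = id"
  by (auto simp: BijGroup_def Bij_def compose_def fun_eq_iff)

lemma S_infty_inv: "bij f \<Longrightarrow> m_inv S_infty f = inv f"
proof -
  assume f: "bij f"
  interpret group S_infty by (rule group_BijGroup)
  show ?thesis
    using f by (intro inv_equality) (auto simp: S_infty_simps bij_imp_bij_inv bij_is_inj)
qed

abbreviation baire_topology :: "(nat \<Rightarrow> nat) topology" where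
  "baire_topology \<equiv> product_topology (\<lambda>_. discrete_topology UNIV) UNIV"

lemma openin_baire_iff:
  "openin baire_topology U \<longleftrightarrow> (\<forall>g\<in>U. \<exists>k. \<forall>h. (\<forall>i<k. h i = g i) \<longrightarrow> h \<in> U)" (is "_ \<longleftrightarrow> ?R")
proof
  assume U: "openin baire_topology U"
  show ?R
  proof
    fix g assume "g \<in> U"
    then obtain V where V: "finite {i. V i \<noteq> UNIV}" "g \<in> Pi\<^sub>E UNIV V" "Pi\<^sub>E UNIV V \<subseteq> U"
      using U unfolding openin_product_topology_alt by auto
    obtain k where k: "\<And>i. V i \<noteq> UNIV \<Longrightarrow> i < k"
      using V(1) finite_nat_set_iff_bounded by auto
    have "h \<in> U" if "\<forall>i<k. h i = g i" for h
    proof -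
      have "h i \<in> V i" for i using that k V(2) by (cases "V i = UNIV") (auto simp: PiE_iff)
      then show ?thesis using V(3) by auto
    qed
    then show "\<exists>k. \<forall>h. (\<forall>i<k. h i = g i) \<longrightarrow> h \<in> U" by blast
  qed
next
  assume R: ?R
  show "openin baire_topology U"
    unfolding openin_product_topology_alt
  proof
    fix g assume "g \<in> U"
    then obtain k where k: "\<And>h. (\<forall>i<k. h i = g i) \<Longrightarrow> h \<in> U" using R by blast
    show "\<exists>V. finite {i \<in> UNIV. V i \<noteq> topspace (discrete_topology (UNIV :: nat set))} \<and>
      (\<forall>i\<in>UNIV. openin (discrete_topology UNIV) (V i)) \<and> g \<in> Pi\<^sub>E UNIV V \<and> Pi\<^sub>E UNIV V \<subseteq> U"
      by (rule exI[of _ "\<lambda>i. if i < k then {g i} else UNIV"])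
        (auto simp: PiE_iff intro!: k split: if_splits)
  qed
qed

lemma completely_metrizable_baire: "completely_metrizable_space baire_topology"
  unfolding completely_metrizable_space_product_topology
  by (auto intro: completely_metrizable_space_discrete_topology)

text \<open>
  Injectivity and surjectivity are countable conjunctions of open conditions. This makes the group of
  all permutations, which is not closed in the Baire space, a Polish space.
\<close>

lemma gdelta_in_S_infty: "gdelta_in baire_topology (carrier S_infty)"
proof -
  have open_ne: "openin baire_topology {f. f a \<noteq> f b}" for a b
    unfolding openin_baire_iff
  proof
    fix g :: "nat \<Rightarrow> nat" assume "g \<in> {f. f a \<noteq> f b}"
    then show "\<exists>k. \<forall>h. (\<forall>i<k. h i = g i) \<longrightarrow> h \<in> {f. f a \<noteq> f b}"
      by (intro exI[of _ "Suc (max a b)"]) auto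
  qed
  have open_range: "openin baire_topology {f. \<exists>x. f x = c}" for c
    unfolding openin_baire_iff
  proof clarsimp
    fix g :: "nat \<Rightarrow> nat" and x
    show "\<exists>k. \<forall>h. (\<forall>i<k. h i = g i) \<longrightarrow> (\<exists>y. h y = g x)"
      by (intro exI[of _ "Suc x"]) auto
  qed
  let ?\<U> = "{{f :: nat \<Rightarrow> nat. f a \<noteq> f b} |a b. a \<noteq> b} \<union> range (\<lambda>c. {f. \<exists>x. f x = c})"
  have "countable ?\<U>"
  proof -
    have "{{f :: nat \<Rightarrow> nat. f a \<noteq> f b} |a b. a \<noteq> b} \<subseteq> range (\<lambda>(a, b). {f. f a \<noteq> f b})" by auto
    then have "countable {{f :: nat \<Rightarrow> nat. f a \<noteq> f b} |a b. a \<noteq> b}"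
      by (rule countable_subset) simp
    then show ?thesis by simp
  qed
  moreover have "carrier S_infty = \<Inter>?\<U>"
  proof (rule Set.set_eqI)
    fix f :: "nat \<Rightarrow> nat"
    have "f \<in> carrier S_infty \<longleftrightarrow> inj f \<and> surj f" by (simp add: S_infty_simps bij_def)
    also have "\<dots> \<longleftrightarrow> (\<forall>a b. a \<noteq> b \<longrightarrow> f a \<noteq> f b) \<and> (\<forall>c. \<exists>x. f x = c)"
      unfolding inj_def surj_def by metis
    also have "\<dots> \<longleftrightarrow> f \<in> \<Inter>?\<U>" by blast
    finally show "f \<in> carrier S_infty \<longleftrightarrow> f \<in> \<Inter>?\<U>" .
  qed
  moreover have "gdelta_in baire_topology (\<Inter>?\<U>)"
  proof (rule gdelta_in_Inter)
    fix S assume "S \<in> ?\<U>"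
    then have "openin baire_topology S" using open_ne open_range by blast
    then show "gdelta_in baire_topology S" by (rule open_imp_gdelta_in)
  qed (use \<open>countable ?\<U>\<close> in auto)
  ultimately show ?thesis by simp
qed

text \<open>
  The relations \<open>near n k\<close> are the basic neighbourhoods in the space of \<open>n\<close>-tuples; conjugation
  is continuous with respect to them.
\<close>

definition near :: "nat \<Rightarrow> nat \<Rightarrow> (nat \<Rightarrow> nat \<Rightarrow> nat) \<Rightarrow> (nat \<Rightarrow> nat \<Rightarrow> nat) \<Rightarrow> bool" where
  "near n k x y \<longleftrightarrow> (\<forall>l<n. \<forall>i<k. x l i = y l i)"

lemma near_sym: "near n k x y \<Longrightarrow> near n k y x"
  and near_trans: "near n k x y \<Longrightarrow> near n k y z \<Longrightarrow> near n k x z"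
  and near_antimono: "near n k x y \<Longrightarrow> j \<le> k \<Longrightarrow> near n j x y"
  and near_refl: "near n k x x"
  by (auto simp: near_def)

definition conj_tuple :: "nat \<Rightarrow> (nat \<Rightarrow> nat) \<Rightarrow> (nat \<Rightarrow> nat \<Rightarrow> nat) \<Rightarrow> (nat \<Rightarrow> nat \<Rightarrow> nat)" where
  "conj_tuple n g x = (\<lambda>l\<in>{..<n}. g \<circ> x l \<circ> inv g)"

lemma conj_tuple_compose:
  "bij g \<Longrightarrow> bij h \<Longrightarrow> conj_tuple n (g \<circ> h) x = conj_tuple n g (conj_tuple n h x)"
  by (auto simp: conj_tuple_def fun_eq_iff o_inv_distrib restrict_def)

lemma conj_tuple_id: "x \<in> extensional {..<n} \<Longrightarrow> conj_tuple n id x = x"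
  by (auto simp: conj_tuple_def fun_eq_iff extensional_def)

lemma conj_tuple_inv:
  "bij g \<Longrightarrow> x \<in> extensional {..<n} \<Longrightarrow> conj_tuple n (inv g) (conj_tuple n g x) = x"
  using conj_tuple_compose[of "inv g" g n x] conj_tuple_id[of x n]
  by (simp add: bij_imp_bij_inv bij_is_inj)

lemma near_conj_tuple:
  "\<exists>k. \<forall>x y. near n k x y \<longrightarrow> near n m (conj_tuple n g x) (conj_tuple n g y)"
proof -
  obtain k where "\<And>j. j < m \<Longrightarrow> inv g j < k"
    using finite_nat_set_iff_bounded[of "inv g ` {..<m}"] by auto
  then show ?thesis by (intro exI[of _ k]) (auto simp: near_def conj_tuple_def)
qed

text \<open>
  The value of \<open>P \<circ> x l \<circ> inv P\<close> at a point depends on \<open>P\<close> and \<open>inv P\<close> at one point each, so it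
  is already attained at a finite stage of the approximation by the \<open>p i\<close>.
\<close>

lemma conj_tuple_limit_eq:
  assumes P: "\<And>i m. m \<le> i \<Longrightarrow> P m = p i m \<and> inv P m = inv (p i) m"
    and Q: "\<And>i m. m \<le> i \<Longrightarrow> Q m = q i m \<and> inv Q m = inv (q i) m"
    and near: "\<And>i. near n i (conj_tuple n (p i) x) (conj_tuple n (q i) z)"
  shows "conj_tuple n P x = conj_tuple n Q z"
proof -
  have "P (x l (inv P j)) = Q (z l (inv Q j))" if "l < n" for l j
  proof -
    define i where "i = Suc (j + x l (inv P j) + z l (inv Q j))"
    have "P (x l (inv P j)) = p i (x l (inv (p i) j))" using P[of j i] P[of "x l (inv P j)" i] by (simp add: i_def)
    also have "\<dots> = q i (z l (inv (q i) j))"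
      using near[of i] that by (simp add: near_def conj_tuple_def i_def)
    also have "\<dots> = Q (z l (inv Q j))" using Q[of j i] Q[of "z l (inv Q j)" i] by (simp add: i_def)
    finally show ?thesis .
  qed
  then show ?thesis by (auto simp: conj_tuple_def fun_eq_iff restrict_def)
qed

locale closed_permutation_group =
  fixes G :: "(nat \<Rightarrow> nat) set"
  assumes subgroup: "subgroup G S_infty" and closed: "closedin S_infty_topology G"
begin

lemma bij: "g \<in> G \<Longrightarrow> bij g"
  using subgroup.subset[OF subgroup] by (auto simp: S_infty_simps)

lemma id_closed: "id \<in> G"
  using subgroup.one_closed[OF subgroup] by (simp add: S_infty_simps)

lemma comp_closed: "g \<in> G \<Longrightarrow> h \<in> G \<Longrightarrow> g \<circ> h \<in> G"
  using subgroup.m_closed[OF subgroup, of g h] by (simp add: S_infty_simps bij)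

lemma inv_closed: "g \<in> G \<Longrightarrow> inv g \<in> G"
  using subgroup.m_inv_closed[OF subgroup, of g] by (simp add: S_infty_inv bij)

lemma group: "group (subgroup_of_S_infty G)"
  using subgroup by (rule subgroup.subgroup_is_group) (rule group_BijGroup)

lemma mult_eq: "g \<in> G \<Longrightarrow> h \<in> G \<Longrightarrow> g \<otimes>\<^bsub>subgroup_of_S_infty G\<^esub> h = g \<circ> h"
  by (simp add: S_infty_simps bij)

lemma inv_eq: "g \<in> G \<Longrightarrow> m_inv (subgroup_of_S_infty G) g = inv g"
  using group.m_inv_consistent[OF group_BijGroup subgroup, of g] by (simp add: S_infty_inv bij)

lemma diagonal_conj_eq:
  assumes "g \<in> G" "x \<in> {..<n} \<rightarrow>\<^sub>E G"
  shows "diagonal_conj (subgroup_of_S_infty G) n g x = conj_tuple n g x"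
  unfolding diagonal_conj_def conj_tuple_def
proof (rule restrict_ext)
  fix i assume "i \<in> {..<n}"
  then have "x i \<in> G" using assms(2) by (rule PiE_mem[rotated])
  then show "g \<otimes>\<^bsub>subgroup_of_S_infty G\<^esub> x i \<otimes>\<^bsub>subgroup_of_S_infty G\<^esub> m_inv (subgroup_of_S_infty G) g
      = g \<circ> x i \<circ> inv g"
    using assms(1) by (simp only: inv_eq mult_eq comp_closed inv_closed)
qed

abbreviation G_top :: "(nat \<Rightarrow> nat) topology" where
  "G_top \<equiv> subtopology S_infty_topology G"

abbreviation tuples :: "nat \<Rightarrow> (nat \<Rightarrow> nat \<Rightarrow> nat) set" where
  "tuples n \<equiv> {..<n} \<rightarrow>\<^sub>E G"

abbreviation tuple_top :: "nat \<Rightarrow> (nat \<Rightarrow> nat \<Rightarrow> nat) topology" where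
  "tuple_top n \<equiv> product_topology (\<lambda>_. G_top) {..<n}"

lemma G_top_eq: "G_top = subtopology baire_topology G"
  using subgroup.subset[OF subgroup]
  by (simp add: S_infty_topology_def subtopology_subtopology inf.absorb2)

lemma topspace_G_top: "topspace G_top = G"
  by (simp add: G_top_eq)

lemma topspace_S_infty_Int [simp]: "topspace S_infty_topology \<inter> G = G"
  using topspace_G_top by simp

lemma topspace_tuple_top: "topspace (tuple_top n) = tuples n"
  by simp

lemma openin_G_top_iff:
  "openin G_top U \<longleftrightarrow> U \<subseteq> G \<and> (\<forall>g\<in>U. \<exists>k. \<forall>h\<in>G. (\<forall>i<k. h i = g i) \<longrightarrow> h \<in> U)" (is "_ \<longleftrightarrow> ?R")
proof
  assume "openin G_top U"
  then obtain T where T: "openin baire_topology T" "U = T \<inter> G"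
    unfolding G_top_eq openin_subtopology by blast
  show ?R
  proof (intro conjI ballI)
    fix g assume "g \<in> U"
    then obtain k where "\<And>h. (\<forall>i<k. h i = g i) \<Longrightarrow> h \<in> T" using T unfolding openin_baire_iff by blast
    then show "\<exists>k. \<forall>h\<in>G. (\<forall>i<k. h i = g i) \<longrightarrow> h \<in> U" using T(2) by blast
  qed (use T in blast)
next
  assume R: ?R
  define T where "T = {f. \<exists>g\<in>U. \<exists>k. (\<forall>h\<in>G. (\<forall>i<k. h i = g i) \<longrightarrow> h \<in> U) \<and> (\<forall>i<k. f i = g i)}"
  have "openin baire_topology T"
    unfolding openin_baire_iff
  proof
    fix f assume "f \<in> T"
    then obtain g k where gk: "g \<in> U" "\<forall>h\<in>G. (\<forall>i<k. h i = g i) \<longrightarrow> h \<in> U" "\<forall>i<k. f i = g i"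
      unfolding T_def by blast
    have "h \<in> T" if "\<forall>i<k. h i = f i" for h
      unfolding T_def using that gk by (intro CollectI bexI[of _ g] exI[of _ k]) auto
    then show "\<exists>k. \<forall>h. (\<forall>i<k. h i = f i) \<longrightarrow> h \<in> T" by blast
  qed
  moreover have "U = T \<inter> G"
  proof
    show "U \<subseteq> T \<inter> G" using R unfolding T_def by blast
    show "T \<inter> G \<subseteq> U" unfolding T_def by blast
  qed
  ultimately show "openin G_top U" unfolding G_top_eq openin_subtopology by blast
qed

lemma openin_tuple_top_iff:
  "openin (tuple_top n) U \<longleftrightarrow>
    U \<subseteq> tuples n \<and> (\<forall>x\<in>U. \<exists>k. \<forall>y\<in>tuples n. near n k x y \<longrightarrow> y \<in> U)" (is "_ \<longleftrightarrow> ?R")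
proof
  assume U: "openin (tuple_top n) U"
  show ?R
  proof (intro conjI ballI)
    show "U \<subseteq> tuples n" using openin_subset[OF U] by simp
    fix x assume "x \<in> U"
    then obtain V where "\<forall>l\<in>{..<n}. openin G_top (V l)"
      and V: "x \<in> Pi\<^sub>E {..<n} V" "Pi\<^sub>E {..<n} V \<subseteq> U"
      using U unfolding openin_product_topology_alt by meson
    have "\<exists>k. \<forall>h\<in>G. (\<forall>i<k. h i = x l i) \<longrightarrow> h \<in> V l" if "l < n" for l
      using \<open>\<forall>l\<in>{..<n}. openin G_top (V l)\<close> V(1) that unfolding openin_G_top_iff by (auto simp: PiE_iff)
    then obtain k where k: "\<And>l h. l < n \<Longrightarrow> h \<in> G \<Longrightarrow> \<forall>i<k l. h i = x l i \<Longrightarrow> h \<in> V l" by metis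
    obtain K where K: "\<And>l. l < n \<Longrightarrow> k l \<le> K"
      using finite_nat_set_iff_bounded_le[of "k ` {..<n}"] by auto
    have "y \<in> U" if "y \<in> tuples n" "near n K x y" for y
    proof -
      have "y l \<in> V l" if "l < n" for l
        using that \<open>near n K x y\<close> \<open>y \<in> tuples n\<close> K[OF that]
        by (intro k) (auto simp: near_def PiE_iff)
      then have "y \<in> Pi\<^sub>E {..<n} V" using \<open>y \<in> tuples n\<close> by (auto simp: PiE_iff)
      then show ?thesis using V(2) by blast
    qed
    then show "\<exists>k. \<forall>y\<in>tuples n. near n k x y \<longrightarrow> y \<in> U" by blast
  qed
next
  assume R: ?R
  show "openin (tuple_top n) U"
    unfolding openin_product_topology_alt
  proof
    fix x assume x: "x \<in> U"
    then obtain k where k: "\<And>y. y \<in> tuples n \<Longrightarrow> near n k x y \<Longrightarrow> y \<in> U"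
      using bspec[OF conjunct2[OF R] x] by blast
    define V where "V l = {h \<in> G. \<forall>i<k. h i = x l i}" for l
    have "openin G_top (V l)" for l
      unfolding openin_G_top_iff V_def by (auto intro!: exI[of _ k])
    moreover have "x \<in> Pi\<^sub>E {..<n} V" using x R by (auto simp: V_def PiE_iff)
    moreover have "Pi\<^sub>E {..<n} V \<subseteq> U"
    proof
      fix y assume "y \<in> Pi\<^sub>E {..<n} V"
      then show "y \<in> U" by (intro k) (auto simp: V_def near_def PiE_iff)
    qed
    ultimately show "\<exists>V. finite {i \<in> {..<n}. V i \<noteq> topspace G_top} \<and>
        (\<forall>i\<in>{..<n}. openin G_top (V i)) \<and> x \<in> Pi\<^sub>E {..<n} V \<and> Pi\<^sub>E {..<n} V \<subseteq> U"
      by (intro exI[of _ V]) auto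
  qed
qed

lemma completely_metrizable_G_top: "completely_metrizable_space G_top"
proof -
  have "completely_metrizable_space S_infty_topology"
    unfolding S_infty_topology_def
    using completely_metrizable_baire gdelta_in_S_infty by (rule completely_metrizable_space_gdelta_in)
  then show ?thesis using closed by (rule completely_metrizable_space_closedin)
qed

lemma completely_metrizable_tuple_top: "completely_metrizable_space (tuple_top n)"
  unfolding completely_metrizable_space_product_topology
  using completely_metrizable_G_top by (auto intro: countable_finite)

lemma second_countable_G_top: "second_countable G_top"
proof -
  define B where "B L = {h \<in> G. map h [0..<length L] = L}" for L
  have B: "B (map g [0..<k]) = {h \<in> G. \<forall>i<k. h i = g i}" for g k
    by (auto simp: B_def)
  show ?thesis
    unfolding second_countable_def
  proof (intro exI[of _ "range B"] conjI ballI allI impI)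
    fix V assume "V \<in> range B"
    then obtain L where V: "V = B L" by blast
    have "h \<in> V" if "g \<in> V" "h \<in> G" "\<forall>i<length L. h i = g i" for g h
    proof -
      have "map h [0..<length L] = map g [0..<length L]" using that by simp
      moreover have "map g [0..<length L] = L" using that(1) unfolding V B_def by simp
      ultimately show ?thesis using that(2) unfolding V B_def by simp
    qed
    moreover have "V \<subseteq> G" unfolding V B_def by blast
    ultimately show "openin G_top V" unfolding openin_G_top_iff by blast
  next
    fix U x assume "openin G_top U \<and> x \<in> U"
    then obtain k where "x \<in> G" "\<forall>h\<in>G. (\<forall>i<k. h i = x i) \<longrightarrow> h \<in> U"
      unfolding openin_G_top_iff by blast
    then show "\<exists>V\<in>range B. x \<in> V \<and> V \<subseteq> U"
      by (intro bexI[of _ "B (map x [0..<k])"] rangeI) (auto simp: B)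
  qed auto
qed

lemma mem_limit:
  assumes "bij P" and "\<And>k. \<exists>g\<in>G. \<forall>i<k. g i = P i"
  shows "P \<in> G"
proof (rule ccontr)
  assume "P \<notin> G"
  have "openin S_infty_topology (topspace S_infty_topology - G)"
    using closed by (simp add: closedin_def)
  then obtain T where T: "openin baire_topology T" "topspace S_infty_topology - G = T \<inter> carrier S_infty"
    unfolding S_infty_topology_def openin_subtopology by blast
  have "P \<in> topspace S_infty_topology - G"
    using \<open>P \<notin> G\<close> assms(1) by (simp add: S_infty_topology_def S_infty_simps)
  then have "P \<in> T" using T by blast
  then obtain k where k: "\<And>h. (\<forall>i<k. h i = P i) \<Longrightarrow> h \<in> T" using T(1) unfolding openin_baire_iff by blast
  obtain g where g: "g \<in> G" "\<forall>i<k. g i = P i" using assms(2) by blast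
  then have "g \<in> T \<inter> carrier S_infty" using k bij by (simp add: S_infty_simps)
  then show False using T(2) g(1) by blast
qed

text \<open>
  A pointwise limit of permutations need not be surjective, but it is a permutation if the inverses
  converge as well; this is completeness of \<open>G\<close> for the two-sided uniformity.
\<close>

lemma ex_limit:
  assumes p: "\<And>i. p i \<in> G"
    and stable: "\<And>i m. m \<le> i \<Longrightarrow> p (Suc i) m = p i m \<and> inv (p (Suc i)) m = inv (p i) m"
  shows "\<exists>P\<in>G. \<forall>i. \<forall>m\<le>i. P m = p i m \<and> inv P m = inv (p i) m"
proof -
  define P Q where "P m = p m m" and "Q m = inv (p m) m" for m
  have PQ: "p i m = P m \<and> inv (p i) m = Q m" if "m \<le> i" for i m
    using that by (induction i rule: dec_induct) (auto simp: P_def Q_def stable)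
  have "P (Q m) = m" for m
    using PQ[of m "max m (Q m)"] PQ[of "Q m" "max m (Q m)"] bij_inv_apply(2)[OF bij[OF p]]
    by (metis max.cobounded1 max.cobounded2)
  moreover have "Q (P m) = m" for m
    using PQ[of m "max m (P m)"] PQ[of "P m" "max m (P m)"] bij_inv_apply(1)[OF bij[OF p]]
    by (metis max.cobounded1 max.cobounded2)
  ultimately have "P \<circ> Q = id" "Q \<circ> P = id" by auto
  then have "bij P" "inv P = Q" by (auto intro: o_bij inv_unique_comp)
  moreover have "P \<in> G"
  proof (rule mem_limit[OF \<open>bij P\<close>])
    show "\<exists>g\<in>G. \<forall>i<k. g i = P i" for k using p PQ by (intro bexI[of _ "p k"]) auto
  qed
  ultimately show ?thesis using PQ by (intro bexI[of _ P]) auto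
qed

definition stab :: "nat \<Rightarrow> (nat \<Rightarrow> nat) set" where
  "stab k = {g \<in> G. \<forall>i<k. g i = i}"

lemma stab_id: "id \<in> stab k" by (simp add: stab_def id_closed)

lemma stab_comp: "g \<in> stab k \<Longrightarrow> h \<in> stab k \<Longrightarrow> g \<circ> h \<in> stab k"
  by (simp add: stab_def comp_closed)

lemma stab_inv:
  assumes "g \<in> stab k" shows "inv g \<in> stab k"
proof -
  have g: "g \<in> G" "\<And>i. i < k \<Longrightarrow> g i = i" using assms by (auto simp: stab_def)
  have "inv g i = i" if "i < k" for i
    using bij_inv_apply(1)[OF bij[OF g(1)], of i] g(2)[OF that] by simp
  then show ?thesis using g(1) inv_closed by (simp add: stab_def)
qed

lemma stab_antimono: "j \<le> k \<Longrightarrow> stab k \<subseteq> stab j" by (auto simp: stab_def)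

text \<open>
  Multiplying \<open>g\<close> on the left by an element of \<open>stab (modulus i g)\<close> changes neither \<open>g\<close> nor its
  inverse on \<open>{..i}\<close>: the modulus exceeds both \<open>i\<close> and all values of \<open>g\<close> on \<open>{..i}\<close>. An infinite
  product in which each factor respects the modulus of the partial product before it therefore
  converges in \<open>G\<close>.
\<close>

definition modulus :: "nat \<Rightarrow> (nat \<Rightarrow> nat) \<Rightarrow> nat" where
  "modulus i g = Suc (i + (\<Sum>m\<le>i. g m))"

lemma modulus_gt: "i < modulus i g" by (simp add: modulus_def)

lemma stab_modulus:
  assumes "g \<in> G" "v \<in> stab (modulus i g)" "m \<le> i"
  shows "(v \<circ> g) m = g m" "inv (v \<circ> g) m = inv g m"
proof -
  have "g m \<le> (\<Sum>m\<le>i. g m)" using assms(3) by (intro member_le_sum) auto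
  then show "(v \<circ> g) m = g m" using assms by (simp add: stab_def modulus_def)
  have "v m = m" "bij v" using assms bij by (auto simp: stab_def modulus_def)
  then have "inv v m = m" using bij_inv_apply(1) by metis
  then show "inv (v \<circ> g) m = inv g m" using bij[OF assms(1)] \<open>bij v\<close> by (simp add: o_inv_distrib)
qed

lemma stab_subset: "stab k \<subseteq> G" by (auto simp: stab_def)

section \<open>Generic orbits\<close>

definition generic_orbit :: "nat \<Rightarrow> (nat \<Rightarrow> nat \<Rightarrow> nat) set \<Rightarrow> bool" where
  "generic_orbit n C \<longleftrightarrow> comeager_in (tuple_top n) C \<and>
    (\<exists>c\<in>tuples n. C = {conj_tuple n g c | g. g \<in> G})"

lemma conj_tuple_closed: "g \<in> G \<Longrightarrow> x \<in> tuples n \<Longrightarrow> conj_tuple n g x \<in> tuples n"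
  by (auto simp: conj_tuple_def PiE_iff comp_closed inv_closed)

lemma generic_orbitD:
  assumes "generic_orbit n C"
  shows generic_orbit_comeager: "comeager_in (tuple_top n) C"
    and generic_orbit_tuples: "x \<in> C \<Longrightarrow> x \<in> tuples n"
    and generic_orbit_conj: "x \<in> C \<Longrightarrow> g \<in> G \<Longrightarrow> conj_tuple n g x \<in> C"
    and generic_orbit_transitive: "x \<in> C \<Longrightarrow> y \<in> C \<Longrightarrow> \<exists>g\<in>G. conj_tuple n g x = y"
    and generic_orbit_nonempty: "C \<noteq> {}"
proof -
  obtain c where c: "c \<in> tuples n" and C: "C = {conj_tuple n g c | g. g \<in> G}"
    using assms unfolding generic_orbit_def by blast
  show "comeager_in (tuple_top n) C" using assms unfolding generic_orbit_def by blast
  show "C \<noteq> {}" using C id_closed by blast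
  show tup: "x \<in> tuples n" if "x \<in> C" for x
    using that C conj_tuple_closed[OF _ c] by blast
  show *: "conj_tuple n g x \<in> C" if "x \<in> C" "g \<in> G" for x g
  proof -
    obtain h where h: "h \<in> G" "x = conj_tuple n h c" using \<open>x \<in> C\<close> C by blast
    then have "conj_tuple n g x = conj_tuple n (g \<circ> h) c"
      using that by (simp add: conj_tuple_compose bij)
    then show ?thesis using C comp_closed h(1) \<open>g \<in> G\<close> by blast
  qed
  show "\<exists>g\<in>G. conj_tuple n g x = y" if "x \<in> C" "y \<in> C" for x y
  proof -
    obtain g where g: "g \<in> G" "x = conj_tuple n g c" using \<open>x \<in> C\<close> C by blast
    obtain h where h: "h \<in> G" "y = conj_tuple n h c" using \<open>y \<in> C\<close> C by blast
    note gh = g h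
    have "conj_tuple n (inv g) x = c"
      using conj_tuple_inv[OF bij[OF gh(1)]] c gh(2) by (simp add: PiE_iff)
    then have "conj_tuple n (h \<circ> inv g) x = y"
      using gh by (simp add: conj_tuple_compose bij inv_closed)
    then show ?thesis using gh comp_closed inv_closed by blast
  qed
qed

text \<open>
  The orbit \<open>C\<close> is the union of countably many translates of the \<open>stab k\<close>-orbit of \<open>x\<close>, one for each
  possible restriction of a permutation to \<open>{..<k}\<close>. By Baire's theorem one of them is dense in
  some open set, and translating it back shows that the \<open>stab k\<close>-orbit of \<open>x\<close> is dense in a
  neighbourhood of \<open>x\<close>.
\<close>

lemma orbit_locally_dense:
  assumes C: "generic_orbit n C" and x: "x \<in> C"
  shows "\<exists>m. \<forall>z\<in>tuples n. near n m x z \<longrightarrow> (\<forall>j. \<exists>v\<in>stab k. near n j z (conj_tuple n v x))"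
proof -
  let ?Y = "tuple_top n"
  \<comment> \<open>\<open>S i\<close> is the set \<open>g \<sqdot> stab k \<sqdot> x\<close> for any \<open>g\<close> in \<open>G\<close> whose restriction to \<open>{..<k}\<close> has code \<open>i\<close>.\<close>
  define S where "S i = {conj_tuple n g x | g. g \<in> G \<and> to_nat (map g [0..<k]) = i}" for i
  have S_sub: "S i \<subseteq> topspace ?Y" for i
    using conj_tuple_closed[OF _ generic_orbit_tuples[OF C x]] by (auto simp: S_def)
  have "\<exists>i. ?Y interior_of (?Y closure_of S i) \<noteq> {}"
  proof (rule ccontr)
    assume "\<nexists>i. ?Y interior_of (?Y closure_of S i) \<noteq> {}"
    then have empty: "?Y interior_of (?Y closure_of S i) = {}" for i by blast
    have "comeager_in ?Y (topspace ?Y - ?Y closure_of S i)" for i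
    proof (rule comeager_in_open_dense)
      show "openin ?Y (topspace ?Y - ?Y closure_of S i)"
        by (intro openin_diff openin_topspace closedin_closure_of)
      show "?Y closure_of (topspace ?Y - ?Y closure_of S i) = topspace ?Y"
        unfolding closure_of_complement empty by simp
    qed
    then have "comeager_in ?Y (\<Inter>i. topspace ?Y - ?Y closure_of S i)" by (rule comeager_in_INT)
    then have "comeager_in ?Y ((\<Inter>i. topspace ?Y - ?Y closure_of S i) \<inter> C)"
      using generic_orbit_comeager[OF C] by (rule comeager_in_Int)
    moreover have "topspace ?Y \<noteq> {}"
      using generic_orbit_tuples[OF C x] topspace_tuple_top by blast
    ultimately have "(\<Inter>i. topspace ?Y - ?Y closure_of S i) \<inter> C \<noteq> {}"
      by (rule comeager_in_nonempty[OF completely_metrizable_tuple_top])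
    then obtain y where "y \<in> (\<Inter>i. topspace ?Y - ?Y closure_of S i)" and yC: "y \<in> C" by blast
    then have y: "y \<in> C" "y \<notin> ?Y closure_of S i" for i by simp_all
    obtain g where g: "g \<in> G" "conj_tuple n g x = y"
      using generic_orbit_transitive[OF C x y(1)] by blast
    then have "y \<in> S (to_nat (map g [0..<k]))" by (auto simp: S_def)
    then show False using y(2) closure_of_subset[OF S_sub] by blast
  qed
  then obtain i y where y: "y \<in> ?Y interior_of (?Y closure_of S i)" by blast
  let ?W = "?Y interior_of (?Y closure_of S i)"
  have "?W \<subseteq> ?Y closure_of S i" by (rule interior_of_subset)
  moreover have W: "openin ?Y ?W" by simp
  ultimately obtain p where p: "p \<in> S i" "p \<in> ?W"
    using y by (meson in_closure_of subsetD)
  obtain g where g: "g \<in> G" "to_nat (map g [0..<k]) = i" "p = conj_tuple n g x"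
    using p(1) by (auto simp: S_def)
  obtain m where m: "\<And>z. z \<in> tuples n \<Longrightarrow> near n m p z \<Longrightarrow> z \<in> ?W"
    using bspec[OF conjunct2[OF iffD1[OF openin_tuple_top_iff W]] p(2)] by blast
  obtain m' where m': "\<And>y z. near n m' y z \<Longrightarrow> near n m (conj_tuple n g y) (conj_tuple n g z)"
    using near_conj_tuple by blast
  have "\<exists>v\<in>stab k. near n j z (conj_tuple n v x)" if z: "z \<in> tuples n" "near n m' x z" for z j
  proof -
    let ?z = "conj_tuple n g z"
    have zt: "?z \<in> tuples n" by (rule conj_tuple_closed[OF g(1) z(1)])
    have zW: "?z \<in> ?Y closure_of S i"
      using subsetD[OF interior_of_subset m[OF zt]] m'[OF z(2)] g(3) by simp
    obtain J where J: "\<And>y z. near n J y z \<Longrightarrow> near n j (conj_tuple n (inv g) y) (conj_tuple n (inv g) z)"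
      using near_conj_tuple by blast
    let ?N = "{y \<in> tuples n. near n J ?z y}"
    have "openin ?Y ?N"
      unfolding openin_tuple_top_iff using near_trans by (auto intro!: exI[of _ J])
    moreover have "?z \<in> ?N" using zt near_refl by simp
    moreover have "?z \<in> ?N \<and> openin ?Y ?N \<longrightarrow> (\<exists>y. y \<in> S i \<and> y \<in> ?N)"
      by (rule spec[OF conjunct2[OF iffD1[OF in_closure_of zW]]])
    ultimately obtain y where "y \<in> S i" "near n J ?z y" by blast
    then obtain h where h: "h \<in> G" "to_nat (map h [0..<k]) = i" "near n J ?z (conj_tuple n h x)"
      by (auto simp: S_def)
    have "map g [0..<k] = map h [0..<k]" using g(2) h(2) by (metis from_nat_to_nat)
    then have "h l = g l" if "l < k" for l using that by simp
    then have "inv g \<circ> h \<in> stab k"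
      using g(1) h(1) by (simp add: stab_def comp_closed inv_closed bij_inv_apply bij)
    moreover have "near n j z (conj_tuple n (inv g \<circ> h) x)"
      using J[OF h(3)] z(1) g(1) h(1)
      by (simp add: conj_tuple_inv conj_tuple_compose bij inv_closed PiE_iff)
    ultimately show ?thesis by blast
  qed
  then show ?thesis by blast
qed

text \<open>
  Let \<open>z \<in> C\<close> be close to \<open>x\<close>. Since small stabilizers have locally dense orbits, \<open>x\<close> can be moved
  by an element of \<open>stab k\<close> very close to \<open>z\<close>, then \<open>z\<close> by an element of a smaller stabilizer even
  closer to the new point, and so on alternately. The products of the elements used on either side
  converge to some \<open>P\<close> and \<open>Q\<close> in \<open>stab k\<close>, and the two moving points have the same limit. So
  \<open>P\<close> conjugates \<open>x\<close> to the tuple to which \<open>Q\<close> conjugates \<open>z\<close>, and \<open>inv Q \<circ> P\<close> moves \<open>x\<close> to \<open>z\<close>.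
\<close>

lemma stab_orbit_relatively_open:
  assumes C: "generic_orbit n C" and x: "x \<in> C"
  shows "\<exists>m. \<forall>z\<in>C. near n m x z \<longrightarrow> (\<exists>v\<in>stab k. conj_tuple n v x = z)"
proof -
  obtain M where M: "\<And>y k z j. y \<in> C \<Longrightarrow> z \<in> tuples n \<Longrightarrow> near n (M y k) y z \<Longrightarrow>
      \<exists>v\<in>stab k. near n j z (conj_tuple n v y)"
    using orbit_locally_dense[OF C] by metis
  have "\<exists>v\<in>stab k. conj_tuple n v x = z"
    if z: "z \<in> C" and xz: "near n (M x (modulus k id)) x z" for z
  proof -
    \<comment> \<open>A state \<open>(r, r')\<close> at step \<open>i\<close> consists of the product on the side that moves next and the one
        on the other side. In each step the two exchange their roles, so that a single rule
        describes both: the side of \<open>x\<close> moves in even steps, that of \<open>z\<close> in odd steps. The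
        invariant \<open>ok\<close> says that the waiting point lies where the orbit of the moving point under
        the stabilizer allowed in step \<open>i\<close> is dense.\<close>
    define w where "w i = (if even i then x else z)" for i :: nat
    have w: "w i \<in> C" for i using x z by (simp add: w_def)
    have wtup: "w i \<in> extensional {..<n}" for i
      using generic_orbit_tuples[OF C w] by (simp add: PiE_iff)
    let ?c = "\<lambda>g i. conj_tuple n g (w i)"
    define ok where "ok i = (\<lambda>(r, r'). r \<in> stab k \<and> r' \<in> stab k \<and>
        near n (M (?c r i) (modulus (k + i) r)) (?c r i) (?c r' (Suc i)))" for i
    define linked where "linked i = (\<lambda>(r, r') (s, s'). s = r' \<and>
        (\<exists>v\<in>stab (modulus (k + i) r). s' = v \<circ> r) \<and> near n i (?c r' (Suc i)) (?c s' i))" for i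
    have "\<exists>f. \<forall>i. ok i (f i) \<and> linked i (f i) (f (Suc i))"
    proof (rule dependent_nat_choice)
      have "ok 0 (id, id)"
        using xz wtup[of 0] wtup[of 1] stab_id by (simp add: ok_def conj_tuple_id) (simp add: w_def)
      then show "\<exists>rr. ok 0 rr" by blast
    next
      fix rr i assume ok: "ok i rr"
      obtain r r' where rr: "rr = (r, r')" by fastforce
      have r: "r \<in> stab k" "r' \<in> stab k" "r \<in> G" "r' \<in> G"
        and nr: "near n (M (?c r i) (modulus (k + i) r)) (?c r i) (?c r' (Suc i))"
        using ok stab_subset by (auto simp: ok_def rr)
      have c: "?c r i \<in> C" "?c r' (Suc i) \<in> C" using generic_orbit_conj[OF C w] r by blast+
      obtain v where v: "v \<in> stab (modulus (k + i) r)"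
        "near n (max i (M (?c r' (Suc i)) (modulus (k + Suc i) r'))) (?c r' (Suc i)) (conj_tuple n v (?c r i))"
        using M[OF c(1) generic_orbit_tuples[OF C c(2)] nr] by blast
      have vG: "v \<in> G" "v \<in> stab k"
        using v(1) stab_subset stab_antimono[of k "modulus (k + i) r"] modulus_gt[of "k + i" r] by auto
      have "conj_tuple n v (?c r i) = ?c (v \<circ> r) i"
        using vG r by (simp add: conj_tuple_compose bij)
      then have vr: "near n (max i (M (?c r' (Suc i)) (modulus (k + Suc i) r'))) (?c r' (Suc i)) (?c (v \<circ> r) i)"
        using v(2) by simp
      have "w (Suc (Suc i)) = w i" by (simp add: w_def)
      then have "ok (Suc i) (r', v \<circ> r)"
        using r(2) stab_comp[OF vG(2) r(1)] near_antimono[OF vr] by (simp add: ok_def)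
      moreover have "linked i rr (r', v \<circ> r)"
        using v(1) near_antimono[OF vr] by (auto simp: linked_def rr)
      ultimately show "\<exists>ss. ok (Suc i) ss \<and> linked i rr ss" by blast
    qed
    then obtain f where f: "\<And>i. ok i (f i)" "\<And>i. linked i (f i) (f (Suc i))" by blast
    define a where "a i = fst (f i)" for i
    have fa: "f i = (a i, a (Suc i))" for i
      using f(2)[of i] by (auto simp: linked_def a_def split: prod.splits)
    have a: "a i \<in> stab k" "a i \<in> G" for i
      using f(1)[of i] stab_subset by (auto simp: ok_def fa)
    have a_step: "\<exists>v\<in>stab (modulus (k + i) (a i)). a (Suc (Suc i)) = v \<circ> a i"
      and a_near: "near n i (?c (a (Suc i)) (Suc i)) (?c (a (Suc (Suc i))) i)" for i
      using f(2)[of i] by (auto simp: linked_def fa)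
    have stable: "a (Suc (Suc i)) m = a i m \<and> inv (a (Suc (Suc i))) m = inv (a i) m" if "m \<le> i" for i m
    proof -
      obtain v where v: "v \<in> stab (modulus (k + i) (a i))" "a (Suc (Suc i)) = v \<circ> a i"
        using a_step by blast
      show ?thesis using stab_modulus[OF a(2) v(1), of m] that v(2) by simp
    qed
    have lim: "\<exists>P\<in>stab k. \<forall>i. \<forall>m\<le>i. P m = a (2 * i + d) m \<and> inv P m = inv (a (2 * i + d)) m" for d
    proof -
      obtain P where P: "P \<in> G" "\<forall>i. \<forall>m\<le>i. P m = a (2 * i + d) m \<and> inv P m = inv (a (2 * i + d)) m"
        using ex_limit[of "\<lambda>i. a (2 * i + d)"] a(2) stable by auto
      moreover have "P m = m" if "m < k" for m
        using P(2)[rule_format, of m m] a(1)[of "2 * m + d"] that by (simp add: stab_def)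
      ultimately show ?thesis by (auto simp: stab_def)
    qed
    obtain P where P: "P \<in> stab k" "\<And>i m. m \<le> i \<Longrightarrow> P m = a (2 * i + 2) m \<and> inv P m = inv (a (2 * i + 2)) m"
      using lim[of 2] by blast
    obtain Q where Q: "Q \<in> stab k" "\<And>i m. m \<le> i \<Longrightarrow> Q m = a (2 * i + 1) m \<and> inv Q m = inv (a (2 * i + 1)) m"
      using lim[of 1] by blast
    have "conj_tuple n P x = conj_tuple n Q z"
    proof (rule conj_tuple_limit_eq[OF P(2) Q(2)])
      fix i
      have "near n (2 * i) (?c (a (Suc (2 * i))) (Suc (2 * i))) (?c (a (Suc (Suc (2 * i)))) (2 * i))"
        by (rule a_near)
      then have "near n (2 * i) (conj_tuple n (a (2 * i + 2)) x) (conj_tuple n (a (2 * i + 1)) z)"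
        by (simp add: w_def near_sym)
      then show "near n i (conj_tuple n (a (2 * i + 2)) x) (conj_tuple n (a (2 * i + 1)) z)"
        by (rule near_antimono) simp
    qed
    then have "conj_tuple n (inv Q \<circ> P) x = z"
      using P(1) Q(1) stab_subset wtup[of 1]
      by (subst conj_tuple_compose) (auto simp: bij bij_imp_bij_inv subset_iff conj_tuple_inv w_def)
    then show ?thesis using stab_comp[OF stab_inv[OF Q(1)] P(1)] by blast
  qed
  then show ?thesis by blast
qed

lemma continuous_map_G_topI:
  assumes "\<And>y. y \<in> G \<Longrightarrow> f y \<in> G"
    and "\<And>m. \<exists>k. \<forall>y\<in>G. \<forall>z\<in>G. (\<forall>i<k. z i = y i) \<longrightarrow> (\<forall>i<m. f z i = f y i)"
  shows "continuous_map G_top G_top f"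
  unfolding continuous_map_def
proof (intro conjI allI impI)
  show "f \<in> topspace G_top \<rightarrow> topspace G_top" using assms(1) by (simp add: topspace_G_top)
  fix U assume U: "openin G_top U"
  show "openin G_top {x \<in> topspace G_top. f x \<in> U}"
    unfolding openin_G_top_iff
  proof (intro conjI ballI)
    fix g assume g: "g \<in> {x \<in> topspace G_top. f x \<in> U}"
    then have fg: "f g \<in> U" and gG: "g \<in> G" by (auto simp: topspace_G_top)
    obtain m where m: "\<And>h. h \<in> G \<Longrightarrow> \<forall>i<m. h i = f g i \<Longrightarrow> h \<in> U"
      using U fg unfolding openin_G_top_iff by blast
    obtain k where k: "\<And>z. z \<in> G \<Longrightarrow> \<forall>i<k. z i = g i \<Longrightarrow> \<forall>i<m. f z i = f g i"
      using assms(2)[of m] gG by blast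
    show "\<exists>k. \<forall>h\<in>G. (\<forall>i<k. h i = g i) \<longrightarrow> h \<in> {x \<in> topspace G_top. f x \<in> U}"
      using m[OF assms(1)] k by (intro exI[of _ k]) (auto simp: topspace_G_top)
  qed (auto simp: topspace_G_top)
qed

lemma continuous_map_two_sided_mult:
  assumes "g \<in> G" "h \<in> G"
  shows "continuous_map G_top G_top (\<lambda>y. g \<circ> y \<circ> h)"
proof (rule continuous_map_G_topI)
  fix m
  obtain k where "\<And>j. j < m \<Longrightarrow> h j < k"
    using finite_nat_set_iff_bounded[of "h ` {..<m}"] by auto
  then show "\<exists>k. \<forall>y\<in>G. \<forall>z\<in>G. (\<forall>i<k. z i = y i) \<longrightarrow> (\<forall>i<m. (g \<circ> z \<circ> h) i = (g \<circ> y \<circ> h) i)"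
    by (intro exI[of _ k]) simp
qed (use assms in \<open>simp add: comp_closed\<close>)

lemma homeomorphic_map_two_sided_mult:
  assumes "g \<in> G" "h \<in> G"
  shows "homeomorphic_map G_top G_top (\<lambda>y. g \<circ> y \<circ> h)"
proof -
  have "homeomorphic_maps G_top G_top (\<lambda>y. g \<circ> y \<circ> h) (\<lambda>y. inv g \<circ> y \<circ> inv h)"
    unfolding homeomorphic_maps_def
    using assms by (simp add: continuous_map_two_sided_mult inv_closed fun_eq_iff bij bij_inv_apply)
  then show ?thesis using homeomorphic_maps_map by blast
qed

text \<open>
  The theorem of Kuratowski and Ulam gives the conclusion for some \<open>x \<in> C\<close>. It carries over to \<open>c\<close>,
  since both orbits are invariant under conjugation.
\<close>

lemma comeager_extensions:
  assumes Cn: "generic_orbit n C" and CS: "generic_orbit (Suc n) C'" and c: "c \<in> C"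
  shows "comeager_in G_top {y \<in> G. c(n := y) \<in> C'}"
proof -
  let ?D = "{x \<in> topspace (tuple_top n). comeager_in G_top {y \<in> topspace G_top. x(n := y) \<in> C'}}"
  have "comeager_in (product_topology (\<lambda>_. G_top) (insert n {..<n})) C'"
    using generic_orbit_comeager[OF CS] by (simp add: lessThan_Suc)
  then have "comeager_in (tuple_top n) ?D"
    using second_countable_G_top by (intro kuratowski_ulam) auto
  then have "comeager_in (tuple_top n) (?D \<inter> C)"
    using generic_orbit_comeager[OF Cn] by (rule comeager_in_Int)
  moreover have "topspace (tuple_top n) \<noteq> {}"
    using generic_orbit_tuples[OF Cn c] topspace_tuple_top by blast
  ultimately have "?D \<inter> C \<noteq> {}"
    by (rule comeager_in_nonempty[OF completely_metrizable_tuple_top])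
  then obtain x where x: "x \<in> C" "comeager_in G_top {y \<in> topspace G_top. x(n := y) \<in> C'}" by blast
  obtain g where g: "g \<in> G" "conj_tuple n g c = x" using generic_orbit_transitive[OF Cn c x(1)] by blast
  have "homeomorphic_map G_top G_top (\<lambda>y. g \<circ> y \<circ> inv g)"
    using g(1) inv_closed[OF g(1)] by (rule homeomorphic_map_two_sided_mult)
  then have "comeager_in G_top {y \<in> topspace G_top. g \<circ> y \<circ> inv g \<in> {y \<in> topspace G_top. x(n := y) \<in> C'}}"
    using x(2) by (rule comeager_in_homeomorphic_preimage)
  then show ?thesis
  proof (rule comeager_in_mono)
    show "{y \<in> topspace G_top. g \<circ> y \<circ> inv g \<in> {y \<in> topspace G_top. x(n := y) \<in> C'}} \<subseteq> {y \<in> G. c(n := y) \<in> C'}"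
    proof clarsimp
      fix y assume y: "y \<in> G" "x(n := g \<circ> y \<circ> inv g) \<in> C'"
      have cy: "c(n := y) \<in> extensional {..<Suc n}"
        using generic_orbit_tuples[OF Cn c] by (auto simp: PiE_iff extensional_def)
      have "x(n := g \<circ> y \<circ> inv g) = conj_tuple (Suc n) g (c(n := y))"
        unfolding g(2)[symmetric] by (auto simp: conj_tuple_def fun_eq_iff restrict_def)
      then have "conj_tuple (Suc n) (inv g) (conj_tuple (Suc n) g (c(n := y))) \<in> C'"
        using generic_orbit_conj[OF CS y(2) inv_closed[OF g(1)]] by simp
      then show "c(n := y) \<in> C'" using conj_tuple_inv[OF bij[OF g(1)] cy] by simp
    qed
  qed (simp add: topspace_G_top)
qed

text \<open>
  Take a generic extension \<open>(c, y0)\<close> with \<open>y0 \<in> A\<close>. All generic tuples in some neighbourhood of it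
  are in its \<open>stab k\<close>-orbit, and as \<open>B\<close> is non-meager near \<open>y0\<close>, one of them is of the form
  \<open>(c, y1)\<close> with \<open>y1 \<in> B\<close>.
\<close>

lemma generic_splitting:
  assumes Cn: "generic_orbit n C" and CS: "generic_orbit (Suc n) C'" and c: "c \<in> C"
    and A: "A \<subseteq> G" "\<not> meager_in G_top A"
    and B: "\<And>U. openin G_top U \<Longrightarrow> U \<noteq> {} \<Longrightarrow> \<not> meager_in G_top (U \<inter> B)"
  shows "\<exists>y0\<in>A. \<exists>y1\<in>G \<inter> B. \<exists>h\<in>stab k. c(n := y0) \<in> C' \<and> c(n := y1) \<in> C' \<and>
    conj_tuple (Suc n) h (c(n := y0)) = c(n := y1)"
proof -
  let ?D = "{y \<in> G. c(n := y) \<in> C'}"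
  have D: "comeager_in G_top ?D" by (rule comeager_extensions[OF Cn CS c])
  have "A \<inter> ?D \<noteq> {}"
  proof
    assume "A \<inter> ?D = {}"
    then have "?D \<subseteq> topspace G_top - A" by (auto simp: topspace_G_top)
    then have "meager_in G_top A" unfolding meager_in_def by (rule comeager_in_mono[OF D]) auto
    then show False using A(2) by blast
  qed
  then obtain y0 where y0: "y0 \<in> A" "c(n := y0) \<in> C'" by blast
  obtain m where m: "\<And>z. z \<in> C' \<Longrightarrow> near (Suc n) m (c(n := y0)) z \<Longrightarrow>
      \<exists>v\<in>stab k. conj_tuple (Suc n) v (c(n := y0)) = z"
    using stab_orbit_relatively_open[OF CS y0(2)] by blast
  let ?U = "{y \<in> G. \<forall>i<m. y i = y0 i}"
  have "openin G_top ?U" unfolding openin_G_top_iff by (auto intro!: exI[of _ m])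
  moreover have "y0 \<in> ?U" using y0 A(1) by auto
  ultimately have nm: "\<not> meager_in G_top (?U \<inter> B)" using B by blast
  have "?U \<inter> B \<inter> ?D \<noteq> {}"
  proof
    assume "?U \<inter> B \<inter> ?D = {}"
    then have "?D \<subseteq> topspace G_top - ?U \<inter> B" by (auto simp: topspace_G_top)
    then have "meager_in G_top (?U \<inter> B)" unfolding meager_in_def by (rule comeager_in_mono[OF D]) auto
    then show False using nm by blast
  qed
  then obtain y1 where y1: "y1 \<in> ?U" "y1 \<in> B" "c(n := y1) \<in> C'" by blast
  have "near (Suc n) m (c(n := y0)) (c(n := y1))" using y1(1) by (auto simp: near_def)
  then show ?thesis using m[OF y1(3)] y0 y1 by blast
qed

end

section \<open>Branching constructions\<close>

lemma uncountable_nat_bool: "uncountable (UNIV :: (nat \<Rightarrow> bool) set)"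
proof
  assume "countable (UNIV :: (nat \<Rightarrow> bool) set)"
  then obtain f :: "(nat \<Rightarrow> bool) \<Rightarrow> nat" where f: "inj f" by (auto simp: countable_def)
  let ?d = "\<lambda>n. \<not> inv f n n"
  have "?d (f ?d) = (\<not> ?d (f ?d))" using inv_f_f[OF f, of ?d] by metis
  then show False by simp
qed

text \<open>
  Otherwise elements of \<open>S m\<close> that agree below \<open>m\<close> would be equal, all \<open>S m\<close> would be finite and
  there would be only countably many branches.
\<close>

lemma late_splitting:
  fixes S :: "nat \<Rightarrow> (nat \<Rightarrow> bool) set"
  assumes "(\<Union>m. S m) = UNIV"
  shows "\<exists>m i a b. m \<le> i \<and> a \<in> S m \<and> b \<in> S m \<and> (\<forall>j<i. a j = b j) \<and> \<not> a i \<and> b i"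
proof (rule ccontr)
  assume none: "\<not> ?thesis"
  have "inj_on (\<lambda>a. {j. j < m \<and> a j}) (S m)" for m
  proof (rule inj_onI, rule ccontr)
    fix a b assume ab: "a \<in> S m" "b \<in> S m" "{j. j < m \<and> a j} = {j. j < m \<and> b j}" "a \<noteq> b"
    define i where "i = (LEAST i. a i \<noteq> b i)"
    have "\<exists>i. a i \<noteq> b i" using \<open>a \<noteq> b\<close> by auto
    then have i: "a i \<noteq> b i" unfolding i_def by (rule LeastI_ex)
    have below: "\<forall>j<i. a j = b j" unfolding i_def using not_less_Least by blast
    have "m \<le> i" using i ab(3) by (metis (mono_tags, lifting) linorder_not_le mem_Collect_eq)
    then show False using none ab(1,2) i below by metis
  qed
  moreover have "finite ((\<lambda>a. {j. j < m \<and> a j}) ` S m)" for m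
    by (rule finite_subset[of _ "Pow {..<m}"]) auto
  ultimately have "finite (S m)" for m by (metis finite_imageD)
  then have "countable (\<Union>m. S m)" by (simp add: countable_finite)
  then show False using assms uncountable_nat_bool by simp
qed

context closed_permutation_group
begin

text \<open>
  The branch \<open>a\<close> determines a growing generic tuple \<open>c a i\<close> and a product \<open>R a i\<close>. At level \<open>i\<close> the
  tuple is extended by \<open>y \<in> A i\<close> if the branch turns left and by \<open>z \<in> B i\<close> if it turns right. In
  the latter case the product is multiplied by an \<open>h\<close> that conjugates \<open>y\<close> to \<open>z\<close> and commutes with
  all earlier entries of the tuple. Hence conjugating the new entry back by the product gives the
  same result on either side, and later factors do not change it. Respecting the modulus
  makes the products converge to \<open>L a\<close>.
\<close>

lemma generic_conjugates_meet:
  fixes C :: "nat \<Rightarrow> (nat \<Rightarrow> nat \<Rightarrow> nat) set"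
  assumes C: "\<And>i. generic_orbit (Suc i) (C i)"
    and A: "\<And>i. A i \<subseteq> G" "\<And>i. \<not> meager_in G_top (A i)"
    and B: "\<And>i U. openin G_top U \<Longrightarrow> U \<noteq> {} \<Longrightarrow> \<not> meager_in G_top (U \<inter> B i)"
  shows "\<exists>L :: (nat \<Rightarrow> bool) \<Rightarrow> nat \<Rightarrow> nat. (\<forall>a. L a \<in> G) \<and>
    (\<forall>a b i. (\<forall>j<i. a j = b j) \<longrightarrow> \<not> a i \<longrightarrow> b i \<longrightarrow>
      (\<exists>y\<in>A i. \<exists>z\<in>G \<inter> B i. inv (L a) \<circ> y \<circ> L a = inv (L b) \<circ> z \<circ> L b))"
proof -
  define splits where "splits i c R y z h \<longleftrightarrow> (c \<in> C i \<longrightarrow> y \<in> A i \<and> z \<in> G \<inter> B i \<and>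
      h \<in> stab (modulus i R) \<and> c(Suc i := y) \<in> C (Suc i) \<and> c(Suc i := z) \<in> C (Suc i) \<and>
      conj_tuple (Suc (Suc i)) h (c(Suc i := y)) = c(Suc i := z))" for i c R y z h
  have "\<exists>y z h. splits i c R y z h" for i c R
    unfolding splits_def using generic_splitting[OF C C _ A(1) A(2) B, of c i i i "modulus i R"] by blast
  then obtain y z h where "\<And>i c R. splits i c R (y i c R) (z i c R) (h i c R)" by metis
  then have split: "y i c R \<in> A i \<and> z i c R \<in> G \<inter> B i \<and>
      h i c R \<in> stab (modulus i R) \<and> c(Suc i := y i c R) \<in> C (Suc i) \<and> c(Suc i := z i c R) \<in> C (Suc i) \<and>
      conj_tuple (Suc (Suc i)) (h i c R) (c(Suc i := y i c R)) = c(Suc i := z i c R)"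
    if "c \<in> C i" for i c R
    using that unfolding splits_def by blast
  obtain c0 where c0: "c0 \<in> C 0" using generic_orbit_nonempty[OF C] by blast
  \<comment> \<open>The tuple at level \<open>i\<close> has length \<open>i + 1\<close>; its first entry \<open>c0 0\<close> is arbitrary, since ample
      generics start with length 1.\<close>
  define child where "child i b = (\<lambda>(c, R). if b then (c(Suc i := z i c R), h i c R \<circ> R)
      else (c(Suc i := y i c R), R))" for i b
  define st where "st a = rec_nat (c0, id) (\<lambda>i. child i (a i))" for a :: "nat \<Rightarrow> bool"
  define c R where "c a i = fst (st a i)" and "R a i = snd (st a i)" for a i
  have st: "st a i = (c a i, R a i)" for a i by (simp add: c_def R_def)
  have zero: "c a 0 = c0" "R a 0 = id" for a by (simp_all add: c_def R_def st_def)
  let ?y = "\<lambda>a i. y i (c a i) (R a i)" and ?z = "\<lambda>a i. z i (c a i) (R a i)"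
    and ?h = "\<lambda>a i. h i (c a i) (R a i)"
  have st_Suc: "st a (Suc i) = child i (a i) (st a i)" for a i by (simp add: st_def)
  have left: "c a (Suc i) = (c a i)(Suc i := ?y a i)" "R a (Suc i) = R a i" if "\<not> a i" for a i
    using st_Suc[of a i] that by (simp_all add: child_def st)
  have right: "c a (Suc i) = (c a i)(Suc i := ?z a i)" "R a (Suc i) = ?h a i \<circ> R a i" if "a i" for a i
    using st_Suc[of a i] that by (simp_all add: child_def st)
  have cC: "c a i \<in> C i" for a i
  proof (induction i)
    case (Suc i)
    show ?case using split[OF Suc, of "R a i"] left(1)[of a i] right(1)[of a i] by (cases "a i") metis+
  qed (use c0 zero in simp)
  note split = split[OF cC]
  have hG: "?h a i \<in> G" for a i using split stab_subset by blast
  have RG: "R a i \<in> G" for a i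
  proof (induction i)
    case (Suc i)
    show ?case using comp_closed[OF hG Suc] Suc left(2)[of a i] right(2)[of a i] by (cases "a i") metis+
  qed (use id_closed zero in metis)
  have "R a (Suc i) m = R a i m \<and> inv (R a (Suc i)) m = inv (R a i) m" if "m \<le> i" for a i m
  proof (cases "a i")
    case True
    then show ?thesis using stab_modulus[OF RG, of "?h a i" i a i m] split that right(2) by metis
  qed (simp add: left)
  then have "\<exists>L\<in>G. \<forall>i. \<forall>m\<le>i. L m = R a i m \<and> inv L m = inv (R a i) m" for a
    by (intro ex_limit RG) blast
  then obtain L where L: "\<And>a. L a \<in> G"
    "\<And>a i m. m \<le> i \<Longrightarrow> L a m = R a i m \<and> inv (L a) m = inv (R a i) m" by metis
  have h_eq: "?h a i \<circ> ((c a i)(Suc i := ?y a i)) l \<circ> inv (?h a i) = ((c a i)(Suc i := ?z a i)) l"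
    if "l \<le> Suc i" for a i l
  proof -
    have "conj_tuple (Suc (Suc i)) (?h a i) ((c a i)(Suc i := ?y a i)) l = ((c a i)(Suc i := ?z a i)) l"
      using split by simp
    then show ?thesis using that by (simp add: conj_tuple_def)
  qed
  have key: "inv (L a) \<circ> c a (Suc i) (Suc i) \<circ> L a = inv (R a i) \<circ> ?y a i \<circ> R a i" for a i
  proof -
    let ?x = "c a (Suc i) (Suc i)"
    have undo: "inv (g \<circ> r) \<circ> t \<circ> (g \<circ> r) = inv r \<circ> s \<circ> r"
      if "g \<circ> s \<circ> inv g = t" "g \<in> G" "r \<in> G" for g r s t
      unfolding that(1)[symmetric] using that(2,3)
      by (simp add: fun_eq_iff o_inv_distrib bij bij_inv_apply)
    have "c a j (Suc i) = ?x \<and> inv (R a j) \<circ> ?x \<circ> R a j = inv (R a i) \<circ> ?y a i \<circ> R a i" if "Suc i \<le> j" for j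
      using that
    proof (induction j rule: dec_induct)
      case base
      show ?case
      proof (cases "a i")
        case True
        then have "?h a i \<circ> ?y a i \<circ> inv (?h a i) = ?x" using h_eq[of "Suc i" i a] right(1) by simp
        then show ?thesis unfolding right(2)[of a i, OF True] by (intro conjI refl undo hG RG)
      qed (simp add: left)
    next
      case (step j)
      show ?case
      proof (cases "a j")
        case True
        have "?h a j \<circ> ?x \<circ> inv (?h a j) = ?x" using h_eq[of "Suc i" j a] step by simp
        then have "inv (R a (Suc j)) \<circ> ?x \<circ> R a (Suc j) = inv (R a j) \<circ> ?x \<circ> R a j"
          unfolding right(2)[of a j, OF True] by (intro undo hG RG)
        moreover have "c a (Suc j) (Suc i) = ?x" using step right(1)[of a j, OF True] by simp
        ultimately show ?thesis using step.IH by (metis (no_types))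
      qed (use step in \<open>simp add: left\<close>)
    qed
    then have stable: "inv (R a j) (?x (R a j m)) = inv (R a i) (?y a i (R a i m))" if "Suc i \<le> j" for j m
      using that by (metis comp_apply)
    have "inv (L a) (?x (L a m)) = inv (R a i) (?y a i (R a i m))" for m
    proof -
      define j where "j = Suc (i + m + ?x (L a m))"
      have "inv (L a) (?x (L a m)) = inv (R a j) (?x (R a j m))"
        using L(2)[of m j a] L(2)[of "?x (L a m)" j a] by (simp add: j_def)
      also have "\<dots> = inv (R a i) (?y a i (R a i m))" by (rule stable) (simp add: j_def)
      finally show ?thesis .
    qed
    then show ?thesis by (simp add: fun_eq_iff)
  qed
  have "\<exists>y\<in>A i. \<exists>z\<in>G \<inter> B i. inv (L a) \<circ> y \<circ> L a = inv (L b) \<circ> z \<circ> L b"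
    if agree: "\<forall>j<i. a j = b j" and a: "\<not> a i" and b: "b i" for a b i
  proof -
    have "st a j = st b j" if "j \<le> i" for j
      using that agree by (induction j) (auto simp: st_def)
    then have "c a i = c b i" "R a i = R b i" by (simp_all add: c_def R_def)
    then have "inv (L a) \<circ> ?y a i \<circ> L a = inv (L b) \<circ> ?z b i \<circ> L b"
      using key[of a i] key[of b i] left(1)[of a i, OF a] right(1)[of b i, OF b] by simp
    then show ?thesis using split by blast
  qed
  then show ?thesis using L(1) by blast
qed

text \<open>
  For branches \<open>a\<close> and \<open>b\<close> that split at level \<open>i\<close>, an element \<open>z\<close> longer than \<open>5 (n0 + i)\<close> is
  conjugate to some \<open>y\<close> of length at most \<open>n0 + i\<close> by \<open>L b \<circ> inv (L a)\<close>. The factor 5 allows for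
  this \<open>y\<close> and for \<open>L a\<close> and \<open>L b\<close>, which occur twice each.
\<close>

lemma length_bounded_on_stab:
  fixes len :: "(nat \<Rightarrow> nat) \<Rightarrow> real"
  assumes C: "\<And>i. generic_orbit (Suc i) (C i)"
    and len_comp: "\<And>g h. g \<in> G \<Longrightarrow> h \<in> G \<Longrightarrow> len (g \<circ> h) \<le> len g + len h"
    and len_inv: "\<And>g. g \<in> G \<Longrightarrow> len (inv g) \<le> len g"
  shows "\<exists>k N. \<forall>g\<in>stab k. len g \<le> N"
proof (rule ccontr)
  assume unbounded: "\<not> ?thesis"
  have mono: "meager_in G_top S" if "meager_in G_top T" "S \<subseteq> T" for S T
    using that unfolding meager_in_def by (meson Diff_mono Diff_subset comeager_in_mono order_refl)
  have large: "\<not> meager_in G_top (U \<inter> {g. 5 * r < len g})"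
    if U: "openin G_top U" "U \<noteq> {}" for U and r :: real
  proof
    assume meager: "meager_in G_top (U \<inter> {g. 5 * r < len g})"
    obtain u where u: "u \<in> U" using U by blast
    obtain k where k: "\<And>h. h \<in> G \<Longrightarrow> \<forall>i<k. h i = u i \<Longrightarrow> h \<in> U"
      using U(1) u unfolding openin_G_top_iff by blast
    let ?N = "{h \<in> G. \<forall>i<k. h i = u i}" and ?S = "topspace G_top - U \<inter> {g. 5 * r < len g}"
    have uG: "u \<in> G" using u U(1) unfolding openin_G_top_iff by blast
    have S: "comeager_in G_top ?S" using meager by (simp add: meager_in_def)
    have N: "openin G_top ?N" unfolding openin_G_top_iff by (auto intro!: exI[of _ k])
    have "len v \<le> 10 * r" if v: "v \<in> stab k" for v
    proof -
      have vG: "v \<in> G" "\<And>i. i < k \<Longrightarrow> v i = i" using v by (auto simp: stab_def)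
      have "homeomorphic_map G_top G_top (\<lambda>y. id \<circ> y \<circ> v)"
        using id_closed vG(1) by (rule homeomorphic_map_two_sided_mult)
      then have "comeager_in G_top {y \<in> topspace G_top. id \<circ> y \<circ> v \<in> ?S}"
        using S by (rule comeager_in_homeomorphic_preimage)
      then have "comeager_in G_top (?S \<inter> {y \<in> topspace G_top. id \<circ> y \<circ> v \<in> ?S})"
        by (rule comeager_in_Int[OF S])
      then have "?S \<inter> {y \<in> topspace G_top. id \<circ> y \<circ> v \<in> ?S} \<inter> ?N \<noteq> {}"
        using N uG by (intro comeager_in_meets_open[OF completely_metrizable_G_top]) auto
      then obtain y where y: "y \<in> G" "\<forall>i<k. y i = u i" "y \<in> ?S" "y \<circ> v \<in> ?S" by auto
      have "y \<in> U" "y \<circ> v \<in> U" using y vG k comp_closed by auto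
      then have "len y \<le> 5 * r" "len (y \<circ> v) \<le> 5 * r" using y(3,4) by auto
      moreover have "inv y \<circ> (y \<circ> v) = v" using y(1) by (simp add: fun_eq_iff bij bij_inv_apply)
      then have "len v \<le> len (inv y) + len (y \<circ> v)"
        using len_comp[OF inv_closed[OF y(1)] comp_closed[OF y(1) vG(1)]] by simp
      ultimately show ?thesis using len_inv[OF y(1)] by simp
    qed
    then show False using unbounded by blast
  qed
  obtain n0 :: nat where n0: "\<not> meager_in G_top {g \<in> G. len g \<le> real n0}"
  proof (rule ccontr)
    assume "\<not> thesis"
    then have "comeager_in G_top (topspace G_top - {g \<in> G. len g \<le> real n})" for n
      using that by (auto simp: meager_in_def)
    then have "comeager_in G_top (\<Inter>n. topspace G_top - {g \<in> G. len g \<le> real n})"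
      by (rule comeager_in_INT)
    moreover have "topspace G_top \<noteq> {}" using id_closed topspace_G_top by blast
    ultimately have "(\<Inter>n. topspace G_top - {g \<in> G. len g \<le> real n}) \<noteq> {}"
      by (rule comeager_in_nonempty[OF completely_metrizable_G_top])
    then obtain g where "g \<in> (\<Inter>n. topspace G_top - {g \<in> G. len g \<le> real n})" by blast
    then have "\<not> len g \<le> real n" for n by (auto simp: topspace_G_top)
    then show False using real_arch_simple by blast
  qed
  define A where "A i = {g \<in> G. len g \<le> real (n0 + i)}" for i
  have "\<not> meager_in G_top (A i)" for i
    using n0 mono[of "A i" "{g \<in> G. len g \<le> real n0}"] by (force simp: A_def)
  then obtain L where L: "\<And>a :: nat \<Rightarrow> bool. L a \<in> G"
    "\<And>a b i. \<forall>j<i. a j = b j \<Longrightarrow> \<not> a i \<Longrightarrow> b i \<Longrightarrow>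
      \<exists>y\<in>A i. \<exists>z\<in>G \<inter> {g. 5 * real (n0 + i) < len g}. inv (L a) \<circ> y \<circ> L a = inv (L b) \<circ> z \<circ> L b"
    using generic_conjugates_meet[of C A "\<lambda>i. {g. 5 * real (n0 + i) < len g}", OF C _ _ large]
    by (auto simp: A_def)
  define S where "S m = {a. len (L a) \<le> real (n0 + m)}" for m
  have U: "(\<Union>m. S m) = UNIV"
  proof -
    have "a \<in> (\<Union>m. S m)" for a
    proof -
      obtain m :: nat where "len (L a) \<le> real m" using real_arch_simple by blast
      then have "a \<in> S m" by (simp add: S_def)
      then show ?thesis by blast
    qed
    then show ?thesis by blast
  qed
  obtain m i a b where "m \<le> i \<and> a \<in> S m \<and> b \<in> S m \<and> (\<forall>j<i. a j = b j) \<and> \<not> a i \<and> b i"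
    using late_splitting[OF U] by (elim exE)
  then have mi: "m \<le> i" and ab: "a \<in> S m" "b \<in> S m"
    and spl: "\<forall>j<i. a j = b j" "\<not> a i" "b i" by simp_all
  obtain y z where y: "y \<in> A i" and z: "z \<in> G" "5 * real (n0 + i) < len z"
    and eq: "inv (L a) \<circ> y \<circ> L a = inv (L b) \<circ> z \<circ> L b"
    using L(2)[OF spl] by blast
  let ?r = "L b \<circ> inv (L a)"
  have r: "?r \<in> G" using L(1) by (simp add: comp_closed inv_closed)
  have "z = L b \<circ> (inv (L b) \<circ> z \<circ> L b) \<circ> inv (L b)"
    using L(1) by (simp add: fun_eq_iff bij bij_inv_apply)
  also have "\<dots> = ?r \<circ> (y \<circ> inv ?r)"
    unfolding eq[symmetric] using L(1) by (simp add: fun_eq_iff o_inv_distrib bij bij_imp_bij_inv inv_inv_eq)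
  finally have "len z \<le> len ?r + (len y + len ?r)"
    using len_comp[OF r comp_closed[of y "inv ?r"]] len_comp[of y "inv ?r"] len_inv[OF r] y r inv_closed[OF r]
    by (simp add: A_def)
  moreover have "len ?r \<le> len (L b) + len (L a)"
    using len_comp[OF L(1) inv_closed[OF L(1)], of b a] len_inv[OF L(1), of a] by simp
  ultimately show False using ab y z(2) mi by (simp add: S_def A_def)
qed

section \<open>Bounded length functions\<close>

text \<open>
  The double coset of \<open>g\<close> is determined by the orbit of the \<open>2 k\<close>-tuple
  \<open>(0, \<dots>, k - 1, g 0, \<dots>, g (k - 1))\<close>: an element that maps the tuple of \<open>f\<close> to the tuple of \<open>g\<close>
  lies in \<open>stab k\<close> and agrees with \<open>g \<circ> inv f\<close> on \<open>f ` {..<k}\<close>.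
\<close>

lemma finite_double_cosets:
  assumes "oligomorphic G"
  shows "\<exists>F\<subseteq>G. finite F \<and> (\<forall>g\<in>G. \<exists>f\<in>F. \<exists>u\<in>stab k. \<exists>v\<in>stab k. g = u \<circ> f \<circ> v)"
proof -
  let ?L = "{xs :: nat list. length xs = 2 * k}"
  let ?orb = "\<lambda>g. Group_Action.orbit (subgroup_of_S_infty G) map ([0..<k] @ map g [0..<k])"
  have "?orb ` G \<subseteq> Group_Action.orbits (subgroup_of_S_infty G) ?L map"
    by (auto simp: Group_Action.orbits_def)
  then have "finite (?orb ` G)" using assms finite_subset unfolding oligomorphic_def by blast
  then obtain F where F: "F \<subseteq> G" "finite F" "?orb ` G = ?orb ` F"
    using finite_subset_image[of "?orb ` G" ?orb G] by blast
  have "\<exists>f\<in>F. \<exists>u\<in>stab k. \<exists>v\<in>stab k. g = u \<circ> f \<circ> v" if g: "g \<in> G" for g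
  proof -
    obtain f where f: "f \<in> F" "?orb g = ?orb f" using F(3) g by blast
    have fG: "f \<in> G" using f(1) F(1) by blast
    have "[0..<k] @ map g [0..<k] \<in> ?orb g"
      unfolding Group_Action.orbit_def using id_closed by (auto intro!: exI[of _ id])
    then have "[0..<k] @ map g [0..<k] \<in> ?orb f" using f(2) by simp
    then obtain u where u: "u \<in> G" "[0..<k] @ map g [0..<k] = map u ([0..<k] @ map f [0..<k])"
      unfolding Group_Action.orbit_def by auto
    have eq: "map u [0..<k] = [0..<k]" "map g [0..<k] = map u (map f [0..<k])"
      using u(2) by auto
    have ui: "u i = i" "g i = u (f i)" if "i < k" for i
      using arg_cong[OF eq(1), of "\<lambda>xs. xs ! i"] arg_cong[OF eq(2), of "\<lambda>xs. xs ! i"] that by auto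
    let ?v = "inv f \<circ> inv u \<circ> g"
    have "u \<in> stab k" using u(1) ui(1) by (simp add: stab_def)
    moreover have "?v \<in> stab k"
      using fG u(1) g ui(2) by (simp add: stab_def comp_closed inv_closed bij bij_inv_apply)
    moreover have "g = u \<circ> f \<circ> ?v" using fG u(1) by (simp add: fun_eq_iff bij bij_inv_apply)
    ultimately show ?thesis using f(1) by blast
  qed
  then show ?thesis using F by blast
qed

lemma generic_orbits_of_ample_generics:
  assumes "ample_generics (subgroup_of_S_infty G) G_top"
  shows "\<exists>C. \<forall>i. generic_orbit (Suc i) (C i)"
proof -
  have "\<exists>C. generic_orbit (Suc i) C" for i
  proof -
    obtain C where C: "C \<in> Group_Action.orbits (subgroup_of_S_infty G) (tuples (Suc i))
        (diagonal_conj (subgroup_of_S_infty G) (Suc i))" "comeager_in (tuple_top (Suc i)) C"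
      using assms unfolding ample_generics_def by force
    then obtain c where c: "c \<in> tuples (Suc i)"
      "C = {diagonal_conj (subgroup_of_S_infty G) (Suc i) g c | g. g \<in> G}"
      unfolding Group_Action.orbits_def Group_Action.orbit_def by auto
    then have "C = {conj_tuple (Suc i) g c | g. g \<in> G}" using diagonal_conj_eq[OF _ c(1)] by force
    then show ?thesis using C(2) c(1) unfolding generic_orbit_def by blast
  qed
  then show ?thesis by metis
qed

theorem length_function_bounded:
  fixes len :: "(nat \<Rightarrow> nat) \<Rightarrow> real"
  assumes "oligomorphic G" and "ample_generics (subgroup_of_S_infty G) G_top"
    and len_comp: "\<And>g h. g \<in> G \<Longrightarrow> h \<in> G \<Longrightarrow> len (g \<circ> h) \<le> len g + len h"
    and len_inv: "\<And>g. g \<in> G \<Longrightarrow> len (inv g) \<le> len g"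
  shows "\<exists>N. \<forall>g\<in>G. len g \<le> N"
proof -
  obtain C where "\<And>i. generic_orbit (Suc i) (C i)"
    using generic_orbits_of_ample_generics[OF assms(2)] by blast
  then obtain k N where N: "\<And>g. g \<in> stab k \<Longrightarrow> len g \<le> N"
    using length_bounded_on_stab[of C len] len_comp len_inv by blast
  obtain F where F: "F \<subseteq> G" "finite F" "\<And>g. g \<in> G \<Longrightarrow> \<exists>f\<in>F. \<exists>u\<in>stab k. \<exists>v\<in>stab k. g = u \<circ> f \<circ> v"
    using finite_double_cosets[OF assms(1), of k] by metis
  obtain M where M: "\<And>f. f \<in> F \<Longrightarrow> len f \<le> M"
    using bdd_above_finite[OF finite_imageI[OF F(2), of len]] by (auto simp: bdd_above_def)
  have "len g \<le> N + M + N" if g: "g \<in> G" for g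
  proof -
    obtain f u v where fuv: "f \<in> F" "u \<in> stab k" "v \<in> stab k" "g = u \<circ> f \<circ> v" using F(3)[OF g] by blast
    then have "u \<in> G" "f \<in> G" "v \<in> G" using F(1) stab_subset by blast+
    then have "len g \<le> len u + len f + len v"
      using len_comp[of "u \<circ> f" v] len_comp[of u f] comp_closed[of u f] fuv(4) by simp
    then show ?thesis using N[OF fuv(2)] N[OF fuv(3)] M[OF fuv(1)] by simp
  qed
  then show ?thesis by blast
qed

end

text \<open>
  A pseudometric that the group does not increase turns an orbit map into a length function on the
  group. The two fixed point properties use this with the distance of a tree and of a Hilbert space.
\<close>

theorem (in closed_permutation_group) bounded_orbits:
  fixes d :: "'x \<Rightarrow> 'x \<Rightarrow> real"
  assumes "oligomorphic G" and "ample_generics (subgroup_of_S_infty G) G_top"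
    and act: "group_action (subgroup_of_S_infty G) E \<phi>" and x0: "x0 \<in> E"
    and triangle: "\<And>x y z. x \<in> E \<Longrightarrow> y \<in> E \<Longrightarrow> z \<in> E \<Longrightarrow> d x z \<le> d x y + d y z"
    and commute: "\<And>x y. x \<in> E \<Longrightarrow> y \<in> E \<Longrightarrow> d x y = d y x"
    and nonexpansive: "\<And>g x y. g \<in> G \<Longrightarrow> x \<in> E \<Longrightarrow> y \<in> E \<Longrightarrow> d (\<phi> g x) (\<phi> g y) \<le> d x y"
  shows "\<exists>N. \<forall>g\<in>G. d x0 (\<phi> g x0) \<le> N"
proof (rule length_function_bounded[OF assms(1,2)])
  interpret group_action "subgroup_of_S_infty G" E \<phi> by (rule act)
  have img: "\<phi> g x \<in> E" if "g \<in> G" "x \<in> E" for g x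
    using element_image[of g x] that by simp
  have comp: "\<phi> (g \<circ> h) x0 = \<phi> g (\<phi> h x0)" if "g \<in> G" "h \<in> G" for g h
    using composition_rule[OF x0, of g h] mult_eq[OF that] that by simp
  show "d x0 (\<phi> (g \<circ> h) x0) \<le> d x0 (\<phi> g x0) + d x0 (\<phi> h x0)" if "g \<in> G" "h \<in> G" for g h
  proof -
    have "d x0 (\<phi> (g \<circ> h) x0) \<le> d x0 (\<phi> g x0) + d (\<phi> g x0) (\<phi> g (\<phi> h x0))"
      unfolding comp[OF that] using that x0 img by (intro triangle) auto
    then show ?thesis using nonexpansive[OF that(1) x0 img[OF that(2) x0]] by simp
  qed
  show "d x0 (\<phi> (inv g) x0) \<le> d x0 (\<phi> g x0)" if g: "g \<in> G" for g
  proof -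
    have "inv g \<circ> g = id" using bij[OF g] by (simp add: bij_is_inj)
    moreover have "\<phi> id x0 = x0" using fun_cong[OF id_eq_one, of x0] x0 by (simp add: S_infty_simps)
    ultimately have "\<phi> (inv g) (\<phi> g x0) = x0" using comp[OF inv_closed[OF g] g] by simp
    then have "d x0 (\<phi> (inv g) x0) \<le> d (\<phi> g x0) x0"
      using nonexpansive[OF inv_closed[OF g] img[OF g x0] x0] by simp
    then show ?thesis using commute[OF x0 img[OF g x0]] by simp
  qed
qed

section \<open>Properties (FA) and (FH)\<close>

theorem corollary1p9:
  fixes G :: "(nat \<Rightarrow> nat) set"
  assumes "subgroup G S_infty"
    and "closedin S_infty_topology G"
    and "oligomorphic G"
    and "ample_generics (subgroup_of_S_infty G) (subtopology S_infty_topology G)"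
  shows "property_FA TYPE('v) (subgroup_of_S_infty G) \<and>
    property_FH TYPE('h::{real_inner, complete_space}) (subgroup_of_S_infty G)"
proof
  let ?H = "subgroup_of_S_infty G"
  interpret closed_permutation_group G using assms(1,2) by (rule closed_permutation_group.intro)
  note bounded = bounded_orbits[OF assms(3,4)]
  show "property_FA TYPE('v) ?H"
    unfolding property_FA_def
  proof (intro allI impI)
    fix T :: "'v pair_pre_digraph" and \<phi>
    assume T_act: "undirected_tree T \<and> acts_without_inversion ?H T \<phi>"
    then have T: "undirected_tree T" and act: "acts_without_inversion ?H T \<phi>" by simp_all
    obtain v0 where v0: "v0 \<in> pverts T" using T unfolding undirected_tree_def by blast
    let ?d = "walk_dist (parcs T)"
    have reach: "(u, v) \<in> (parcs T)\<^sup>*" if "u \<in> pverts T" "v \<in> pverts T" for u v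
      using undirected_tree_reach[OF T that] .
    have nonexpansive: "?d (\<phi> g u) (\<phi> g v) \<le> ?d u v"
      if g: "g \<in> G" and uv: "u \<in> pverts T" "v \<in> pverts T" for g u v
    proof (intro walk_dist_le relpow_image[OF relpow_walk_dist[OF reach[OF uv]]])
      fix a b assume "(a, b) \<in> parcs T"
      then show "(\<phi> g a, \<phi> g b) \<in> parcs T"
        using act g undirected_tree_arc_verts[OF T]
        by (simp add: acts_without_inversion_def acts_by_automorphisms_def)
    qed
    have "\<exists>N. \<forall>g\<in>G. real (?d v0 (\<phi> g v0)) \<le> N"
    proof (rule bounded[of "pverts T"])
      show "group_action ?H (pverts T) \<phi>"
        using act by (simp add: acts_without_inversion_def acts_by_automorphisms_def)
      show "real (?d u w) \<le> real (?d u v) + real (?d v w)"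
        if "u \<in> pverts T" "v \<in> pverts T" "w \<in> pverts T" for u v w
        using walk_dist_triangle[OF reach reach, of u v w] that by linarith
      show "real (?d u v) = real (?d v u)" if "u \<in> pverts T" "v \<in> pverts T" for u v
        using walk_dist_commute[OF undirected_tree_sym[OF T] reach[OF that]] by simp
    qed (use v0 nonexpansive in auto)
    then obtain N where N: "\<And>g. g \<in> G \<Longrightarrow> real (?d v0 (\<phi> g v0)) \<le> N" by blast
    have "?d v0 (\<phi> g v0) \<le> nat \<lceil>N\<rceil>" if "g \<in> carrier ?H" for g
      using N[of g] that by (simp add: nat_ceiling_le_eq le_nat_iff) linarith
    then show "\<exists>v\<in>pverts T. \<forall>g\<in>carrier ?H. \<phi> g v = v"
      by (rule tree_bounded_orbit_fixed_vertex[OF T act group v0])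
  qed
  show "property_FH TYPE('h) ?H"
    unfolding property_FH_def
  proof (intro allI impI)
    fix \<phi> :: "(nat \<Rightarrow> nat) \<Rightarrow> 'h \<Rightarrow> 'h"
    assume "group_action ?H UNIV \<phi> \<and> (\<forall>g\<in>carrier ?H. \<forall>x y. dist (\<phi> g x) (\<phi> g y) = dist x y)"
    then have act: "group_action ?H UNIV \<phi>"
      and isom: "\<And>g x y. g \<in> carrier ?H \<Longrightarrow> dist (\<phi> g x) (\<phi> g y) = dist x y" by blast+
    have "\<exists>N. \<forall>g\<in>G. dist 0 (\<phi> g 0) \<le> N"
      using isom by (intro bounded[OF act]) (auto simp: dist_triangle dist_commute)
    then obtain N where "\<And>g. g \<in> G \<Longrightarrow> dist 0 (\<phi> g 0) \<le> N" by blast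
    then have "bounded ((\<lambda>g. \<phi> g 0) ` carrier ?H)"
      unfolding bounded_def by (intro exI[of _ 0] exI[of _ N]) simp
    with act group isom show "\<exists>x. \<forall>g\<in>carrier ?H. \<phi> g x = x"
      by (rule hilbert_bounded_orbit_fixed_point)
  qed
qed

end
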